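(* Let $p\in(1,\infty]$ and let $\sigma$ be a finite measure on $\mathbb{S}^{d-1}_+=\mathbb{S}^{d-1}\cap\mathbb{R}_+^d$. A random vector $\xi\in\mathbb{R}^d_+$ is strictly stable for $p$-sums with $\alpha=1$ and spectral measure $\sigma$ if and only if $$\mathbf{E}\chi_u(\xi)=e^{-h(K,u)},\qquad u\in\mathbb{R}_+^d,$$ where $K$ is the $L_1(p)$-zonoid with spectral measure $\Gamma(1-\frac1p)\,\sigma$ (with $\frac1p=0$ if $p=\infty$).
   Context: $\mathbb{R}_+^d=[0,\infty)^d$. For $x,y\in\mathbb{R}_+^d$ and $p\in(0,\infty)$ the $p$-sum $x+_py$ is the vector with coordinates $(x_i^p+y_i^p)^{1/p}$; for $p=\infty$ it is the coordinatewise maximum. A random vector $\xi$ in $\mathbb{R}_+^d$ is strictly stable for $p$-sums with characteristic exponent $\alpha$ if $a^{1/\alpha}\xi_1+_pb^{1/\alpha}\xi_2$ has the same distribution as $(a+b)^{1/\alpha}\xi$ for all $a,b>0$, with $\xi_1,\xi_2$ independent copies of $\xi$. For $u\in\mathbb{R}_+^d$: $\chi_u(x)=\exp\{-\sum_{i=1}^d(x_iu_i)^p\}$ if $p<\infty$; $\chi_u(x)=1$ if $x_iu_i\le1$ for all $i$ and $\chi_u(x)=0$ otherwise, if $p=\infty$. The vector $\xi$ (with exponent $\alpha<p$) has spectral measure $\sigma$ on $\mathbb{S}^{d-1}_+$ if $\mathbf{E}\chi_u(\xi)=\exp\{-\int_{\mathbb{R}_+^d}(1-\chi_u(x))\Lambda(dx)\}$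 for all $u\in\mathbb{R}_+^d$, where the L\'evy measure $\Lambda$ has in polar coordinates $x=ty$, $t>0$, $y\in\mathbb{S}^{d-1}_+$, the form $\alpha t^{-\alpha-1}dt\,\sigma(dy)$. The support function of a set $A$ is $h(A,u)=\sup\{\langle x,u\rangle:x\in A\}$. The $L_1(p)$-zonoid, $p\in[1,\infty]$, with spectral measure $\mu$ (a finite measure on $\mathbb{S}^{d-1}_+$ with total mass $c$) is $K=c\,\mathbf{E}X$, where $X=\eta B_q^d=\{(\eta_1v_1,\dots,\eta_dv_d):v\in\mathbb{R}^d,\ \|v\|_q\le1\}$, $p^{-1}+q^{-1}=1$, $\eta$ has distribution $c^{-1}\mu$, and $\mathbf{E}X$ is the convex compact set with support function $\mathbf{E}h(X,u)$ (and $K=\{0\}$ if $c=0$). *)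

theory Defs
  imports "HOL-Probability.Probability"
begin

text \<open>The exponent \<open>p\<close> of a \<open>p\<close>-sum is an extended real in \<open>(0,\<infinity>]\<close>, and dimension \<open>d\<close> is
  \<open>CARD('n)\<close>. The convention \<open>0 powr a = 0\<close> agrees with the intended \<open>0\<^sup>a = 0\<close> for \<open>a > 0\<close>.\<close>

definition nonneg_orthant :: "(real ^ 'n) set" where
  "nonneg_orthant = {x. \<forall>i. 0 \<le> x $ i}"

definition nonneg_sphere :: "(real ^ 'n) set" where
  "nonneg_sphere = sphere 0 1 \<inter> nonneg_orthant"

definition p_sum :: "ereal \<Rightarrow> real ^ 'n \<Rightarrow> real ^ 'n \<Rightarrow> real ^ 'n" where
  "p_sum p x y =
    (if p = \<infinity> then (\<chi> i. max (x $ i) (y $ i))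
     else (\<chi> i. ((x $ i) powr real_of_ereal p + (y $ i) powr real_of_ereal p)
                   powr (1 / real_of_ereal p)))"

text \<open>The independent copies of \<open>\<xi>\<close> are its two coordinate copies on the product space
  \<open>M \<Otimes>\<^sub>M M\<close>. Only their joint law matters: see \<open>strictly_p_stable_copies\<close> below.\<close>

definition strictly_p_stable ::
  "ereal \<Rightarrow> real \<Rightarrow> 'w measure \<Rightarrow> ('w \<Rightarrow> real ^ 'n) \<Rightarrow> bool" where
  "strictly_p_stable p \<alpha> M \<xi> \<longleftrightarrow>
    (\<forall>a>0. \<forall>b>0.
      distr (M \<Otimes>\<^sub>M M) borel
        (\<lambda>(\<omega>1, \<omega>2). p_sum p (a powr (1 / \<alpha>) *\<^sub>R \<xi> \<omega>1) (b powr (1 / \<alpha>) *\<^sub>R \<xi> \<omega>2))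
      = distr M borel (\<lambda>\<omega>. (a + b) powr (1 / \<alpha>) *\<^sub>R \<xi> \<omega>))"

definition chi_fun :: "ereal \<Rightarrow> real ^ 'n \<Rightarrow> real ^ 'n \<Rightarrow> real" where
  "chi_fun p u x =
    (if p = \<infinity> then (if \<forall>i. x $ i * u $ i \<le> 1 then 1 else 0)
     else exp (- (\<Sum>i\<in>UNIV. (x $ i * u $ i) powr real_of_ereal p)))"

text \<open>The image of \<open>\<alpha> t\<^sup>-\<^sup>\<alpha>\<^sup>-\<^sup>1 dt \<otimes> \<sigma>(dy)\<close> under \<open>(t, y) \<mapsto> t y\<close>.\<close>

definition levy_measure :: "real \<Rightarrow> (real ^ 'n) measure \<Rightarrow> (real ^ 'n) measure" where
  "levy_measure \<alpha> \<sigma> =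
    distr (density lborel (\<lambda>t. indicator {0<..} t * ennreal (\<alpha> * t powr (- \<alpha> - 1))) \<Otimes>\<^sub>M \<sigma>)
      borel (\<lambda>(t, y). t *\<^sub>R y)"

text \<open>Meant for \<open>0 < \<alpha> < p\<close>; then the integrand is integrable for every finite \<open>\<sigma>\<close> on the
  nonnegative part of the sphere.\<close>

definition has_spectral_measure ::
  "ereal \<Rightarrow> real \<Rightarrow> 'w measure \<Rightarrow> ('w \<Rightarrow> real ^ 'n) \<Rightarrow> (real ^ 'n) measure \<Rightarrow> bool" where
  "has_spectral_measure p \<alpha> M \<xi> \<sigma> \<longleftrightarrow>
    (\<forall>u\<in>nonneg_orthant.
      (\<integral>\<omega>. chi_fun p u (\<xi> \<omega>) \<partial>M) = exp (- (\<integral>x. (1 - chi_fun p u x) \<partial>levy_measure \<alpha> \<sigma>)))"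

definition support_function :: "(real ^ 'n) set \<Rightarrow> real ^ 'n \<Rightarrow> real" where
  "support_function A u = (SUP x\<in>A. x \<bullet> u)"

definition set_expectation :: "'w measure \<Rightarrow> ('w \<Rightarrow> (real ^ 'n) set) \<Rightarrow> (real ^ 'n) set" where
  "set_expectation M X =
    (THE A. A \<noteq> {} \<and> convex A \<and> compact A \<and>
      (\<forall>u. support_function A u = (\<integral>\<omega>. support_function (X \<omega>) u \<partial>M)))"

definition lq_norm :: "ereal \<Rightarrow> real ^ 'n \<Rightarrow> real" where
  "lq_norm q v =
    (if q = \<infinity> then Max (range (\<lambda>i. \<bar>v $ i\<bar>))
     else (\<Sum>i\<in>UNIV. \<bar>v $ i\<bar> powr real_of_ereal q) powr (1 / real_of_ereal q))"

definition lq_ball :: "ereal \<Rightarrow> (real ^ 'n) set" where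
  "lq_ball q = {v. lq_norm q v \<le> 1}"

text \<open>Inversion in \<open>ereal\<close> has \<open>inverse \<infinity> = 0\<close> and \<open>inverse 0 = \<infinity>\<close>, so the endpoints \<open>1\<close> and
  \<open>\<infinity>\<close> are conjugate.\<close>

definition conj_exponent :: "ereal \<Rightarrow> ereal" where
  "conj_exponent p = inverse (1 - inverse p)"

lemma conj_exponent:
  assumes "1 \<le> p"
  shows "1 \<le> conj_exponent p" "inverse p + inverse (conj_exponent p) = 1"
proof -
  have "1 \<le> conj_exponent p \<and> inverse p + inverse (conj_exponent p) = 1"
  proof (cases p)
    case (real r)
    with assms have r: "1 \<le> r" by (simp add: one_ereal_def)
    show ?thesis
    proof (cases "r = 1")
      case True
      with real show ?thesis by (simp add: conj_exponent_def one_ereal_def zero_ereal_def)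
    next
      case False
      with r have "r > 1" by simp
      then have "1 - 1 / r > 0" "1 - 1 / r \<le> 1" by (simp_all add: field_simps)
      with real \<open>r > 1\<close> show ?thesis
        by (auto simp: conj_exponent_def one_ereal_def field_simps)
    qed
  next
    case PInf
    then show ?thesis by (simp add: conj_exponent_def one_ereal_def)
  next
    case MInf
    with assms show ?thesis by simp
  qed
  then show "1 \<le> conj_exponent p" "inverse p + inverse (conj_exponent p) = 1" by auto
qed

definition coord_scale :: "real ^ 'n \<Rightarrow> (real ^ 'n) set \<Rightarrow> (real ^ 'n) set" where
  "coord_scale y B = (\<lambda>v. \<chi> i. y $ i * v $ i) ` B"

text \<open>The random vector \<open>\<eta>\<close> is the identity map on the probability space given by \<open>\<mu> / c\<close>.\<close>

definition L1_zonoid :: "ereal \<Rightarrow> (real ^ 'n) measure \<Rightarrow> (real ^ 'n) set" where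
  "L1_zonoid p \<mu> =
    (let c = measure \<mu> (space \<mu>) in
      if c = 0 then {0}
      else (*\<^sub>R) c ` set_expectation (scale_measure (ennreal (1 / c)) \<mu>)
                      (\<lambda>\<eta>. coord_scale \<eta> (lq_ball (conj_exponent p))))"

lemma p_sum_measurable [measurable]:
  fixes f g :: "'w \<Rightarrow> real ^ 'n"
  assumes [measurable]: "f \<in> borel_measurable M" "g \<in> borel_measurable M"
  shows "(\<lambda>\<omega>. p_sum p (f \<omega>) (g \<omega>)) \<in> borel_measurable M"
proof (rule borel_measurable_euclidean_space[THEN iffD2], rule ballI)
  fix b :: "real ^ 'n" assume "b \<in> Basis"
  then obtain i where b: "b = axis i 1" by (auto simp: Basis_vec_def)
  have [measurable]: "(\<lambda>\<omega>. f \<omega> $ i) \<in> borel_measurable M" "(\<lambda>\<omega>. g \<omega> $ i) \<in> borel_measurable M"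
    by (simp_all add: cart_eq_inner_axis)
  show "(\<lambda>\<omega>. p_sum p (f \<omega>) (g \<omega>) \<bullet> b) \<in> borel_measurable M"
    unfolding b cart_eq_inner_axis[symmetric] p_sum_def by (cases "p = \<infinity>") simp_all
qed

lemma strictly_p_stable_copies:
  fixes \<xi> :: "'w \<Rightarrow> real ^ 'n" and \<xi>1 \<xi>2 :: "'v \<Rightarrow> real ^ 'n"
  assumes "prob_space M" and [measurable]: "\<xi> \<in> borel_measurable M"
    and "prob_space N" and "prob_space.indep_var N borel \<xi>1 borel \<xi>2"
    and "distr N borel \<xi>1 = distr M borel \<xi>" "distr N borel \<xi>2 = distr M borel \<xi>"
  shows "strictly_p_stable p \<alpha> M \<xi> \<longleftrightarrow>
    (\<forall>a>0. \<forall>b>0.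
      distr N borel (\<lambda>\<omega>. p_sum p (a powr (1 / \<alpha>) *\<^sub>R \<xi>1 \<omega>) (b powr (1 / \<alpha>) *\<^sub>R \<xi>2 \<omega>))
      = distr M borel (\<lambda>\<omega>. (a + b) powr (1 / \<alpha>) *\<^sub>R \<xi> \<omega>))"
proof -
  interpret M: prob_space M by fact
  interpret N: prob_space N by fact
  have [measurable]: "\<xi>1 \<in> borel_measurable N" "\<xi>2 \<in> borel_measurable N"
    using N.indep_var_rv1[OF assms(4)] N.indep_var_rv2[OF assms(4)] by auto
  have law: "distr N (borel \<Otimes>\<^sub>M borel) (\<lambda>\<omega>. (\<xi>1 \<omega>, \<xi>2 \<omega>)) =
      distr (M \<Otimes>\<^sub>M M) (borel \<Otimes>\<^sub>M borel) (\<lambda>(\<omega>1, \<omega>2). (\<xi> \<omega>1, \<xi> \<omega>2))"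
  proof -
    have "distr N (borel \<Otimes>\<^sub>M borel) (\<lambda>\<omega>. (\<xi>1 \<omega>, \<xi>2 \<omega>)) =
        distr M borel \<xi> \<Otimes>\<^sub>M distr M borel \<xi>"
      using assms(4-6) by (simp add: N.indep_var_distribution_eq)
    also have "\<dots> = distr (M \<Otimes>\<^sub>M M) (borel \<Otimes>\<^sub>M borel) (\<lambda>(\<omega>1, \<omega>2). (\<xi> \<omega>1, \<xi> \<omega>2))"
      by (rule pair_measure_distr)
        (use prob_space_imp_sigma_finite[OF M.prob_space_distr[OF assms(2)]] in auto)
    finally show ?thesis .
  qed
  have "distr N borel (\<lambda>\<omega>. p_sum p (s *\<^sub>R \<xi>1 \<omega>) (t *\<^sub>R \<xi>2 \<omega>)) =
      distr (M \<Otimes>\<^sub>M M) borel (\<lambda>(\<omega>1, \<omega>2). p_sum p (s *\<^sub>R \<xi> \<omega>1) (t *\<^sub>R \<xi> \<omega>2))" for s t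
  proof -
    have m: "(\<lambda>(x, y). p_sum p (s *\<^sub>R x) (t *\<^sub>R y)) \<in>
        borel_measurable ((borel :: (real ^ 'n) measure) \<Otimes>\<^sub>M borel)"
      by measurable
    from arg_cong[OF law, of "\<lambda>L. distr L borel (\<lambda>(x, y). p_sum p (s *\<^sub>R x) (t *\<^sub>R y))"]
    show ?thesis
      by (simp add: distr_distr[OF m[unfolded split_beta']] o_def split_beta')
  qed
  then show ?thesis by (simp add: strictly_p_stable_def)
qed

end

theory Submission
  imports Defs
begin

text \<open>
  Both sides of the equivalence are exponentials of the same integral of \<open>l\<^sub>p\<close>-norms over the sphere.

  Write \<open>x * u\<close> for the coordinatewise product. On the orthant \<open>\<chi>\<^sub>u x\<close> depends on \<open>x\<close> only
  through \<open>\<parallel>x * u\<parallel>\<^sub>p\<close>: it is \<open>\<phi> (\<parallel>x * u\<parallel>\<^sub>p)\<close>, where \<open>\<phi> s\<close> is \<open>exp (- s\<^sup>p)\<close>, or the indicator of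
  \<open>s \<le> 1\<close> if \<open>p = \<infinity>\<close>. In polar coordinates \<open>x = t y\<close> the exponent of the spectral representation
  therefore has the inner integral \<open>\<integral> (1 - \<phi> (t s)) t\<^sup>-\<^sup>2 dt\<close> over \<open>t > 0\<close> with \<open>s = \<parallel>y * u\<parallel>\<^sub>p\<close>. By
  scaling it is linear in \<open>s\<close>, which is special to \<open>\<alpha> = 1\<close>, and its slope is \<open>\<Gamma> (1 - 1 / p)\<close>
  (\<open>levy_integral\<close>). On the other side \<open>h (\<eta> B\<^sub>q, u) = h (B\<^sub>q, \<eta> * u) = \<parallel>\<eta> * u\<parallel>\<^sub>p\<close>, because the
  norms with conjugate exponents are dual. So \<open>h (K, u)\<close> is the integral of \<open>\<parallel>y * u\<parallel>\<^sub>p\<close> against the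
  spectral measure of \<open>K\<close> (\<open>support_function_L1_zonoid\<close>), and the factor \<open>\<Gamma> (1 - 1 / p)\<close> in
  that measure makes the two exponents agree. Hence the formula with \<open>h (K, u)\<close> says exactly that
  \<open>\<xi>\<close> has spectral measure \<open>\<sigma>\<close>.

  It remains to see that the formula forces stability. The functions \<open>\<chi>\<^sub>u\<close> turn \<open>p\<close>-sums into
  products and \<open>h (K, \<cdot>)\<close> is positively homogeneous, so the laws on both sides of the stability
  identity have the transform \<open>exp (- (a + b) h (K, u))\<close>. The transform determines the law
  (\<open>chi_fun_determines\<close>). For \<open>p = \<infinity>\<close> it is a distribution function. For \<open>p < \<infinity>\<close> the
  map \<open>x\<^sub>i \<mapsto> exp (- x\<^sub>i\<^sup>p)\<close> carries the orthant into a cube and the transform at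
  \<open>u\<^sub>i = k\<^sub>i\<^sup>1\<^sup>/\<^sup>p\<close> to the mixed moment of orders \<open>k\<^sub>i\<close>; by the Stone--Weierstrass theorem the moments
  determine a measure on a compact set.
\<close>

section \<open>Support functions and expectations of random sets\<close>

lemma support_function_scale_image:
  "support_function ((*\<^sub>R) c ` A) u = support_function A (c *\<^sub>R u)"
  by (simp add: support_function_def image_image)

lemma bounded_inner_bdd_above:
  fixes A :: "(real ^ 'n) set"
  assumes "bounded A"
  shows "bdd_above ((\<lambda>x. x \<bullet> u) ` A)"
proof -
  have "bounded ((\<lambda>x. x \<bullet> u) ` A)"
    by (rule bounded_linear_image[OF assms bounded_linear_inner_left])
  then show ?thesis by (rule bounded_imp_bdd_above)
qed

lemma inner_le_support_function:
  assumes "bounded A" "x \<in> A"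
  shows "x \<bullet> u \<le> support_function A u"
  unfolding support_function_def
  using assms by (intro cSUP_upper bounded_inner_bdd_above)

lemma support_function_le:
  assumes "A \<noteq> {}" "\<And>x. x \<in> A \<Longrightarrow> x \<bullet> u \<le> t"
  shows "support_function A u \<le> t"
  unfolding support_function_def using assms by (intro cSUP_least) auto

lemma support_function_add_le:
  assumes "bounded A" "A \<noteq> {}"
  shows "support_function A (u + v) \<le> support_function A u + support_function A v"
  by (rule support_function_le[OF assms(2)])
    (auto simp: inner_add_right intro!: add_mono inner_le_support_function assms)

lemma support_function_scaleR:
  assumes "bounded A" "A \<noteq> {}" "0 \<le> c"
  shows "support_function A (c *\<^sub>R u) = c * support_function A u"
proof (cases "c = 0")
  case True
  then show ?thesis using assms by (simp add: support_function_def)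
next
  case False
  with assms have c: "c > 0" by simp
  have "support_function A (s *\<^sub>R v) \<le> s * support_function A v" if "s > 0" for s v
    using that assms by (intro support_function_le) (auto intro!: inner_le_support_function)
  from this[OF c, of u] this[of "inverse c" "c *\<^sub>R u"] show ?thesis
    using c by (simp add: field_simps)
qed

text \<open>A point of \<open>A\<close> outside \<open>B\<close> would be strictly separated from \<open>B\<close> by a hyperplane, and the
  two support functions, evaluated at its normal, would be in the wrong order.\<close>

lemma closed_convex_subset_of_support_function_le:
  assumes "closed B" "convex B" "bounded A" "B \<noteq> {}"
    and le: "\<And>u. support_function A u \<le> support_function B u"
  shows "A \<subseteq> B"
proof
  fix x assume x: "x \<in> A"
  show "x \<in> B"
  proof (rule ccontr)
    assume "x \<notin> B"
    then obtain a b where ab: "a \<bullet> x < b" "\<And>y. y \<in> B \<Longrightarrow> b < a \<bullet> y"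
      using separating_hyperplane_closed_point[OF assms(2,1)] by blast
    have "support_function B (- a) \<le> - b"
      using ab(2) assms(4) by (intro support_function_le) (auto simp: inner_commute less_imp_le)
    moreover have "x \<bullet> (- a) \<le> support_function A (- a)"
      by (rule inner_le_support_function[OF assms(3) x])
    ultimately show False using le[of "- a"] ab(1) by (simp add: inner_commute)
  qed
qed

lemma support_function_inject:
  assumes "compact A" "convex A" "A \<noteq> {}" "compact B" "convex B" "B \<noteq> {}"
    and "\<And>u. support_function A u = support_function B u"
  shows "A = B"
  using assms
  by (intro equalityI closed_convex_subset_of_support_function_le)
    (auto simp: compact_imp_closed compact_imp_bounded)

text \<open>A finite-dimensional Hahn--Banach theorem. The epigraph of \<open>f\<close> is a closed convex cone, so
  a hyperplane separates it from the point \<open>(u0, t)\<close> strictly below the graph. The hyperplane cannot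
  be vertical, and its slope is the functional \<open>x\<close>. As \<open>t\<close> increases to
  \<open>f u0\<close> these functionals recover \<open>f u0\<close> as a supremum.\<close>

lemma sublinear_minorant:
  fixes f :: "real ^ 'n \<Rightarrow> real"
  assumes add: "\<And>u v. f (u + v) \<le> f u + f v"
    and scale: "\<And>c u. 0 \<le> c \<Longrightarrow> f (c *\<^sub>R u) = c * f u"
    and t: "t < f u0"
  obtains x where "\<And>u. x \<bullet> u \<le> f u" "t < x \<bullet> u0"
proof -
  have cvx: "convex_on UNIV f"
  proof (rule convex_onI)
    fix s u v assume "0 < s" "s < (1::real)"
    then show "f ((1 - s) *\<^sub>R u + s *\<^sub>R v) \<le> (1 - s) * f u + s * f v"
      using add[of "(1 - s) *\<^sub>R u" "s *\<^sub>R v"] by (simp add: scale)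
  qed simp
  have cont: "continuous_on UNIV f" by (rule convex_on_continuous[OF open_UNIV cvx])
  have "closed {z :: (real^'n) \<times> real. f (fst z) \<le> snd z}"
    by (intro closed_Collect_le continuous_intros continuous_on_compose2[OF cont]) auto
  then have clo: "closed (epigraph UNIV f)" by (simp add: epigraph_def)
  have "(u0, t) \<notin> epigraph UNIV f" using t by (simp add: epigraph_def)
  from separating_hyperplane_closed_point[OF convex_epigraphI[OF cvx] clo this]
  obtain ab c where *: "ab \<bullet> (u0, t) < c" "\<forall>z\<in>epigraph UNIV f. ab \<bullet> z > c" by blast
  obtain a b where ab: "ab = (a, b)" by (cases ab)
  have sep: "a \<bullet> u0 + b * t < c" "\<And>u s. f u \<le> s \<Longrightarrow> c < a \<bullet> u + b * s"
    using * by (auto simp: ab epigraph_def)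
  have f0: "f 0 = 0" using scale[of 0 0] by simp
  have c0: "c < 0" using sep(2)[of 0 0] f0 by simp
  \<comment> \<open>The epigraph is a cone, so a point with a negative value could be rescaled to have the value \<open>c\<close>.\<close>
  have cone: "0 \<le> a \<bullet> u + b * s" if us: "f u \<le> s" for u s
  proof (rule ccontr)
    assume neg: "\<not> 0 \<le> a \<bullet> u + b * s"
    define k where "k = c / (a \<bullet> u + b * s)"
    have k: "0 \<le> k" using neg c0 by (simp add: k_def divide_nonpos_nonpos)
    have "f (k *\<^sub>R u) \<le> k * s" using us k by (simp add: scale mult_left_mono)
    from sep(2)[OF this] have "c < k * (a \<bullet> u + b * s)" by (simp add: algebra_simps)
    then show False using neg by (simp add: k_def)
  qed
  \<comment> \<open>The points \<open>(u0, t)\<close> and \<open>(u0, f u0)\<close> lie on different sides and differ only in height.\<close>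
  have "0 < b * (f u0 - t)" using sep(1) cone[of u0 "f u0"] c0 by (simp add: algebra_simps)
  then have b: "b > 0" using t by (simp add: zero_less_mult_iff)
  show ?thesis
  proof
    show "(- (1 / b)) *\<^sub>R a \<bullet> u \<le> f u" for u
      using cone[of u "f u"] b by (simp add: field_simps)
    show "t < (- (1 / b)) *\<^sub>R a \<bullet> u0"
      using sep(1) c0 b by (simp add: field_simps)
  qed
qed

text \<open>The set is that of all linear minorants of \<open>f\<close>. It is an intersection of closed
  half-spaces, bounded by the values of \<open>f\<close> at the positive and negative unit vectors.\<close>

lemma sublinear_is_support_function:
  fixes f :: "real ^ 'n \<Rightarrow> real"
  assumes add: "\<And>u v. f (u + v) \<le> f u + f v"
    and scale: "\<And>c u. 0 \<le> c \<Longrightarrow> f (c *\<^sub>R u) = c * f u"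
  obtains A where "A \<noteq> {}" "convex A" "compact A" "\<And>u. support_function A u = f u"
proof
  define A where "A = {x. \<forall>u. x \<bullet> u \<le> f u}"
  have A_Int: "A = (\<Inter>u. {x. u \<bullet> x \<le> f u})" by (auto simp: A_def inner_commute)
  obtain x0 where "\<And>u. x0 \<bullet> u \<le> f u"
    using sublinear_minorant[of f "f 0 - 1" 0, OF add scale] by auto
  then show ne: "A \<noteq> {}" by (auto simp: A_def)
  show "convex A" unfolding A_Int by (intro convex_INT convex_halfspace_le)
  have clo: "closed A" unfolding A_Int by (intro closed_INT ballI closed_halfspace_le)
  have "A \<subseteq> {(\<chi> i. - f (axis i (- 1))) .. (\<chi> i. f (axis i 1))}"
  proof
    fix x assume "x \<in> A"
    then have "x \<bullet> axis i 1 \<le> f (axis i 1)" "x \<bullet> axis i (- 1) \<le> f (axis i (- 1))" for i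
      by (auto simp: A_def)
    then show "x \<in> {(\<chi> i. - f (axis i (- 1))) .. (\<chi> i. f (axis i 1))}"
      by (auto simp: less_eq_vec_def inner_axis minus_le_iff)
  qed
  then have bd: "bounded A" using bounded_closed_interval bounded_subset by metis
  with clo show "compact A" by (simp add: compact_eq_bounded_closed)
  show "support_function A u = f u" for u
  proof (rule antisym)
    show "support_function A u \<le> f u"
      by (rule support_function_le[OF ne]) (simp add: A_def)
    show "f u \<le> support_function A u"
    proof (rule dense_le)
      fix t assume "t < f u"
      then obtain x where "\<And>v. x \<bullet> v \<le> f v" "t < x \<bullet> u"
        using sublinear_minorant[of f t u, OF add scale] by blast
      then show "t \<le> support_function A u"
        using inner_le_support_function[OF bd, of x u] by (simp add: A_def)
    qed
  qed
qed

text \<open>Integration keeps sublinearity, so a compact convex set with the integrated support function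
  exists, and it is unique because a compact convex set is determined by its support function. This
  is what gives the definite description of \<open>set_expectation\<close> its meaning.\<close>

lemma support_function_set_expectation:
  fixes X :: "'w \<Rightarrow> (real ^ 'n) set"
  assumes X: "\<And>\<omega>. \<omega> \<in> space M \<Longrightarrow> bounded (X \<omega>)" "\<And>\<omega>. \<omega> \<in> space M \<Longrightarrow> X \<omega> \<noteq> {}"
    and int: "\<And>u. integrable M (\<lambda>\<omega>. support_function (X \<omega>) u)"
  shows "support_function (set_expectation M X) u = (\<integral>\<omega>. support_function (X \<omega>) u \<partial>M)"
proof -
  define f where "f u = (\<integral>\<omega>. support_function (X \<omega>) u \<partial>M)" for u
  have "f (u + v) \<le> f u + f v" for u v
  proof -
    have "f (u + v) \<le> (\<integral>\<omega>. support_function (X \<omega>) u + support_function (X \<omega>) v \<partial>M)"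
      unfolding f_def
      by (intro integral_mono int Bochner_Integration.integrable_add support_function_add_le X)
    then show ?thesis by (simp add: f_def int)
  qed
  moreover have "f (c *\<^sub>R u) = c * f u" if "0 \<le> c" for c u
  proof -
    have "f (c *\<^sub>R u) = (\<integral>\<omega>. c * support_function (X \<omega>) u \<partial>M)"
      unfolding f_def
      by (intro Bochner_Integration.integral_cong refl support_function_scaleR X that)
    then show ?thesis by (simp add: f_def)
  qed
  ultimately obtain A where A: "A \<noteq> {}" "convex A" "compact A" "\<And>u. support_function A u = f u"
    using sublinear_is_support_function[of f] by metis
  have "set_expectation M X = A"
    unfolding set_expectation_def
  proof (rule the_equality)
    show "A \<noteq> {} \<and> convex A \<and> compact A \<and>
        (\<forall>u. support_function A u = (\<integral>\<omega>. support_function (X \<omega>) u \<partial>M))"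
      using A by (simp add: f_def)
    fix B assume "B \<noteq> {} \<and> convex B \<and> compact B \<and>
        (\<forall>u. support_function B u = (\<integral>\<omega>. support_function (X \<omega>) u \<partial>M))"
    then show "B = A" using A by (intro support_function_inject) (auto simp: f_def)
  qed
  then show ?thesis using A by (simp add: f_def)
qed

section \<open>Duality of the norms with conjugate exponents\<close>

lemma borel_measurable_vec_nth [measurable (raw)]:
  fixes f :: "'w \<Rightarrow> real ^ 'n"
  assumes "f \<in> borel_measurable M"
  shows "(\<lambda>\<omega>. f \<omega> $ i) \<in> borel_measurable M"
  using assms by (simp add: cart_eq_inner_axis)

lemma borel_measurable_vec_lambda [measurable (raw)]:
  fixes f :: "'n::finite \<Rightarrow> 'w \<Rightarrow> real"
  assumes "\<And>i. f i \<in> borel_measurable M"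
  shows "(\<lambda>\<omega>. \<chi> i. f i \<omega>) \<in> borel_measurable M"
proof (rule borel_measurable_euclidean_space[THEN iffD2], rule ballI)
  fix b :: "real ^ 'n" assume "b \<in> Basis"
  then obtain i where "b = axis i 1" by (auto simp: Basis_vec_def)
  then show "(\<lambda>\<omega>. (\<chi> i. f i \<omega>) \<bullet> b) \<in> borel_measurable M"
    using assms by (simp add: inner_axis)
qed

lemma borel_measurable_lq_norm [measurable (raw)]:
  fixes f :: "'w \<Rightarrow> real ^ 'n"
  assumes [measurable]: "f \<in> borel_measurable M"
  shows "(\<lambda>\<omega>. lq_norm p (f \<omega>)) \<in> borel_measurable M"
proof (cases "p = \<infinity>")
  case True
  have "(\<lambda>\<omega>. Max ((\<lambda>i. \<bar>f \<omega> $ i\<bar>) ` UNIV)) \<in> borel_measurable M"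
    by (rule borel_measurable_Max) auto
  with True show ?thesis by (simp add: lq_norm_def)
qed (simp add: lq_norm_def)

lemma lq_norm_nonneg: "0 \<le> lq_norm p w"
proof (cases "p = \<infinity>")
  case True
  have "0 \<le> \<bar>w $ undefined\<bar>" by simp
  also have "\<dots> \<le> Max (range (\<lambda>i. \<bar>w $ i\<bar>))" by (intro Max_ge) auto
  finally show ?thesis using True by (simp add: lq_norm_def)
qed (simp add: lq_norm_def)

lemma lq_norm_mono:
  assumes "0 \<le> p" "\<And>i. \<bar>v $ i\<bar> \<le> \<bar>w $ i\<bar>"
  shows "lq_norm p v \<le> lq_norm p w"
proof (cases "p = \<infinity>")
  case True
  have "\<bar>v $ i\<bar> \<le> Max (range (\<lambda>i. \<bar>w $ i\<bar>))" for i
    by (rule order_trans[OF assms(2)]) (intro Max_ge; simp)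
  then show ?thesis using True by (auto simp: lq_norm_def intro!: Max.boundedI)
next
  case False
  then show ?thesis using assms
    by (auto simp: lq_norm_def real_of_ereal_pos
        intro!: powr_mono2 sum_mono sum_nonneg)
qed

lemma conj_exponent_infinity: "conj_exponent \<infinity> = 1"
  by (simp add: conj_exponent_def)

lemma conj_exponent_ereal:
  assumes "1 < r"
  shows "conj_exponent (ereal r) = ereal (r / (r - 1))"
proof -
  have "1 - 1 / r = (r - 1) / r" "(r - 1) / r \<noteq> 0" using assms by (simp_all add: field_simps)
  then show ?thesis using assms by (simp add: conj_exponent_def one_ereal_def inverse_eq_divide)
qed

lemma lq_ball_ereal:
  assumes "0 < s"
  shows "lq_ball (ereal s) = {v. (\<Sum>i\<in>UNIV. \<bar>v $ i\<bar> powr s) \<le> 1}"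
proof -
  have "S powr (1 / s) \<le> 1 \<longleftrightarrow> S \<le> 1" if "S \<ge> 0" for S :: real
    using that assms powr_le1[of "1 / s" S] gr_one_powr[of S "1 / s"] by (auto simp: not_le[symmetric])
  then show ?thesis by (simp add: lq_ball_def lq_norm_def sum_nonneg)
qed

lemma lq_ball_bounds:
  assumes "0 < q"
  shows "bounded (lq_ball q :: (real ^ 'n) set)" "lq_ball q \<noteq> ({} :: (real ^ 'n) set)"
proof -
  have "\<bar>v $ i\<bar> \<le> 1" if v: "v \<in> lq_ball q" for v :: "real ^ 'n" and i
  proof (cases q)
    case (real s)
    with assms have s: "0 < s" by simp
    have "\<bar>v $ i\<bar> powr s \<le> (\<Sum>i\<in>UNIV. \<bar>v $ i\<bar> powr s)" by (rule member_le_sum) auto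
    also have "\<dots> \<le> 1" using v s real by (simp add: lq_ball_ereal)
    finally show ?thesis using s gr_one_powr[of "\<bar>v $ i\<bar>" s] by (auto simp: not_le[symmetric])
  next
    case PInf
    have "\<bar>v $ i\<bar> \<le> Max (range (\<lambda>i. \<bar>v $ i\<bar>))" by (intro Max_ge) auto
    also have "\<dots> \<le> 1" using v PInf by (simp add: lq_ball_def lq_norm_def)
    finally show ?thesis .
  qed (use assms in simp)
  then have "lq_ball q \<subseteq> {- 1 .. (1 :: real ^ 'n)}"
    by (auto simp: less_eq_vec_def abs_le_iff minus_le_iff)
  then show "bounded (lq_ball q :: (real ^ 'n) set)"
    using bounded_closed_interval bounded_subset by metis
  have "(0 :: real ^ 'n) \<in> lq_ball q"
    using assms by (cases q) (auto simp: lq_ball_ereal lq_ball_def lq_norm_def)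
  then show "lq_ball q \<noteq> ({} :: (real ^ 'n) set)" by blast
qed

text \<open>The upper bound is Hoelder's inequality, from Young's inequality for the coordinates of
  \<open>w / \<parallel>w\<parallel>\<^sub>r\<close> and \<open>v\<close>. Equality holds for \<open>v\<^sub>i\<close> proportional to \<open>sgn w\<^sub>i \<bar>w\<^sub>i\<bar>\<^sup>r\<^sup>-\<^sup>1\<close>, and the
  factor \<open>\<parallel>w\<parallel>\<^sub>r\<^sup>1\<^sup>-\<^sup>r\<close> puts \<open>v\<close> on the unit sphere since \<open>(r - 1) q = r\<close>.\<close>

lemma support_function_lq_ball_ereal:
  assumes r: "1 < r"
  shows "support_function (lq_ball (ereal (r / (r - 1)))) w = lq_norm (ereal r) w"
proof -
  define q where "q = r / (r - 1)"
  have q: "1 < q" "1 / r + 1 / q = 1" and rq: "(r - 1) * q = r"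
    using r by (auto simp: q_def field_simps)
  define N where "N = lq_norm (ereal r) w"
  have N: "N = (\<Sum>i\<in>UNIV. \<bar>w $ i\<bar> powr r) powr (1 / r)"
    by (simp add: N_def lq_norm_def)
  have Nr: "(\<Sum>i\<in>UNIV. \<bar>w $ i\<bar> powr r) = N powr r"
    unfolding N powr_powr using r by (simp add: sum_nonneg)
  have ball: "lq_ball (ereal q) = {v::real^'a. (\<Sum>i\<in>UNIV. \<bar>v $ i\<bar> powr q) \<le> 1}"
    using q by (intro lq_ball_ereal) simp
  have "support_function (lq_ball (ereal q)) w = N"
  proof (cases "N = 0")
    case True
    with Nr r have "\<forall>i. \<bar>w $ i\<bar> powr r = 0" by (simp add: sum_nonneg_eq_0_iff)
    then have "w = 0" by (simp add: vec_eq_iff)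
    then show ?thesis using True lq_ball_bounds(2)[of "ereal q", where ?'n = 'a] q
      by (simp add: support_function_def)
  next
    case False
    then have N0: "N > 0" using lq_norm_nonneg[of "ereal r" w] by (simp add: N_def)
    show ?thesis
    proof (rule antisym)
      show "support_function (lq_ball (ereal q)) w \<le> N"
      proof (rule support_function_le)
        fix v :: "real ^ 'a" assume v: "v \<in> lq_ball (ereal q)"
        have "v \<bullet> w = N * (\<Sum>i\<in>UNIV. v $ i * (w $ i / N))"
          using N0 by (simp add: inner_vec_def sum_distrib_left)
        also have "\<dots> \<le> N * (\<Sum>i\<in>UNIV. \<bar>w $ i\<bar> powr r / N powr r / r + \<bar>v $ i\<bar> powr q / q)"
        proof (intro mult_left_mono sum_mono)
          fix i
          have "v $ i * (w $ i / N) \<le> \<bar>v $ i * (w $ i / N)\<bar>" by (rule abs_ge_self)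
          also have "\<dots> = (\<bar>w $ i\<bar> / N) * \<bar>v $ i\<bar>" using N0 by (simp add: abs_mult)
          also have "\<dots> \<le> (\<bar>w $ i\<bar> / N) powr r / r + \<bar>v $ i\<bar> powr q / q"
            by (rule Youngs_inequality) (use r q N0 in auto)
          also have "(\<bar>w $ i\<bar> / N) powr r = \<bar>w $ i\<bar> powr r / N powr r"
            using N0 by (simp add: powr_divide)
          finally show "v $ i * (w $ i / N) \<le> \<bar>w $ i\<bar> powr r / N powr r / r + \<bar>v $ i\<bar> powr q / q" .
        qed (use N0 in simp)
        also have "\<dots> = N * (1 / r + (\<Sum>i\<in>UNIV. \<bar>v $ i\<bar> powr q) / q)"
          using N0 by (simp only: sum.distrib sum_divide_distrib[symmetric] Nr) simp
        also have "\<dots> \<le> N * (1 / r + 1 / q)"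
          using v q N0 by (intro mult_left_mono add_left_mono divide_right_mono) (auto simp: ball)
        finally show "v \<bullet> w \<le> N" using q by simp
      qed (use lq_ball_bounds(2)[of q] q in simp)
    next
      define v :: "real ^ 'a" where "v = (\<chi> i. sgn (w $ i) * (\<bar>w $ i\<bar> powr (r - 1) / N powr (r - 1)))"
      have "\<bar>v $ i\<bar> powr q = \<bar>w $ i\<bar> powr r / N powr r" for i
        using N0 q by (simp add: v_def abs_mult powr_mult powr_divide powr_powr rq abs_sgn_eq)
      then have "(\<Sum>i\<in>UNIV. \<bar>v $ i\<bar> powr q) = 1"
        using N0 by (simp only: sum_divide_distrib[symmetric] Nr) simp
      then have "v \<bullet> w \<le> support_function (lq_ball (ereal q)) w"
        using q by (intro inner_le_support_function lq_ball_bounds) (auto simp: ball)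
      moreover have "v $ i * w $ i = \<bar>w $ i\<bar> powr r / N powr (r - 1)" for i
      proof -
        have "v $ i * w $ i = (w $ i * sgn (w $ i)) * \<bar>w $ i\<bar> powr (r - 1) / N powr (r - 1)"
          by (simp add: v_def mult_ac)
        also have "\<dots> = \<bar>w $ i\<bar> powr r / N powr (r - 1)"
          using powr_mult_base[of "\<bar>w $ i\<bar>" "r - 1"] by (simp only: abs_sgn[symmetric]) simp
        finally show ?thesis .
      qed
      then have "v \<bullet> w = N powr r / N powr (r - 1)"
        by (simp add: inner_vec_def sum_divide_distrib[symmetric] Nr)
      moreover have "N powr r / N powr (r - 1) = N"
        using N0 by (simp flip: powr_diff)
      ultimately show "N \<le> support_function (lq_ball (ereal q)) w" by simp
    qed
  qed
  then show ?thesis by (simp add: q_def N_def)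
qed

text \<open>The maximum over the cross-polytope is attained at a vertex, in the coordinate where
  \<open>\<bar>w\<^sub>i\<bar>\<close> is largest.\<close>

lemma support_function_lq_ball_1:
  "support_function (lq_ball 1) w = lq_norm \<infinity> w"
proof -
  have ball: "lq_ball 1 = {v::real^'a. (\<Sum>i\<in>UNIV. \<bar>v $ i\<bar>) \<le> 1}"
    using lq_ball_ereal[of 1] by (simp add: one_ereal_def)
  define N where "N = lq_norm \<infinity> w"
  have N: "N = Max (range (\<lambda>i. \<bar>w $ i\<bar>))" by (simp add: N_def lq_norm_def)
  have le: "\<bar>w $ i\<bar> \<le> N" for i unfolding N by (intro Max_ge) auto
  have N0: "0 \<le> N" by (simp add: N_def lq_norm_nonneg)
  have "support_function (lq_ball 1) w = N"
  proof (rule antisym)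
    show "support_function (lq_ball 1) w \<le> N"
    proof (rule support_function_le)
      fix v :: "real ^ 'a" assume v: "v \<in> lq_ball 1"
      have "v \<bullet> w \<le> (\<Sum>i\<in>UNIV. \<bar>v $ i\<bar> * N)"
        unfolding inner_vec_def
      proof (intro sum_mono)
        fix i
        have "v $ i \<bullet> w $ i \<le> \<bar>v $ i\<bar> * \<bar>w $ i\<bar>" by (simp add: abs_mult[symmetric])
        also have "\<dots> \<le> \<bar>v $ i\<bar> * N" using le by (intro mult_left_mono) auto
        finally show "v $ i \<bullet> w $ i \<le> \<bar>v $ i\<bar> * N" .
      qed
      also have "\<dots> \<le> N"
        using v N0 by (simp add: ball sum_distrib_right[symmetric] mult_left_le_one_le sum_nonneg)
      finally show "v \<bullet> w \<le> N" .
    qed (use lq_ball_bounds(2)[of 1] in simp)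
    have "N \<in> range (\<lambda>i. \<bar>w $ i\<bar>)" unfolding N by (rule Max_in) auto
    then obtain i where i: "N = \<bar>w $ i\<bar>" by auto
    have "axis i (sgn (w $ i)) \<in> lq_ball 1"
      by (simp add: ball axis_def if_distrib[of abs] abs_sgn_eq cong: if_cong)
    from inner_le_support_function[OF lq_ball_bounds(1) this, of w]
    show "N \<le> support_function (lq_ball 1) w"
      by (simp add: inner_axis' i abs_sgn mult.commute)
  qed
  then show ?thesis by (simp add: N_def)
qed

lemma conj_exponent_pos:
  assumes "1 \<le> p" shows "0 < conj_exponent p"
  using conj_exponent(1)[OF assms] order.strict_trans2[of 0 1 "conj_exponent p"] by simp

lemma support_function_lq_ball:
  assumes "1 < p"
  shows "support_function (lq_ball (conj_exponent p)) w = lq_norm p w"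
  using assms
  by (cases p) (simp_all add: conj_exponent_ereal support_function_lq_ball_ereal
      conj_exponent_infinity support_function_lq_ball_1)

text \<open>Homogeneity is inherited from support functions by duality, which covers finite and infinite
  exponents at once.\<close>

lemma lq_norm_scaleR:
  assumes "1 < p" "0 \<le> c"
  shows "lq_norm p (c *\<^sub>R w) = c * lq_norm p w"
  using support_function_scaleR[OF lq_ball_bounds[of "conj_exponent p"] assms(2), of w]
    conj_exponent_pos[of p] assms(1)
  by (simp add: support_function_lq_ball)

text \<open>Scaling by coordinates is a diagonal, hence self-adjoint, linear map.\<close>

lemma support_function_coord_scale:
  "support_function (coord_scale y B) u = support_function B (y * u)"
proof -
  have "(\<chi> i. y $ i * v $ i) \<bullet> u = v \<bullet> (y * u)" for v
    by (simp add: inner_vec_def mult_ac)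
  then show ?thesis by (simp add: support_function_def coord_scale_def image_image)
qed

lemma coord_scale_bounds:
  assumes "bounded B" "B \<noteq> {}"
  shows "bounded (coord_scale y B)" "coord_scale y B \<noteq> {}"
proof -
  have "bounded_linear (\<lambda>v. \<chi> i. y $ i * v $ i)"
    by (intro linear_conv_bounded_linear[THEN iffD1] linearI)
      (simp_all add: vec_eq_iff distrib_left)
  then show "bounded (coord_scale y B)"
    unfolding coord_scale_def by (rule bounded_linear_image[OF assms(1)])
  show "coord_scale y B \<noteq> {}" using assms(2) by (simp add: coord_scale_def)
qed

section \<open>The support function of the zonoid\<close>

lemma scale_measure_eq_density: "scale_measure c M = density M (\<lambda>_. c)"
  by (rule measure_eqI) (simp_all add: emeasure_density nn_integral_cmult_indicator)

lemma restrict_borel_sets_ident: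
  assumes "sets \<mu> = sets (restrict_space borel S)"
  shows "(\<lambda>y. y) \<in> borel_measurable \<mu>" "space \<mu> = S"
proof -
  show "space \<mu> = S" using sets_eq_imp_space_eq[OF assms] by (simp add: space_restrict_space)
  show "(\<lambda>y. y) \<in> borel_measurable \<mu>"
    unfolding measurable_cong_sets[OF assms refl] by (rule measurable_restrict_space1) simp
qed

lemma lq_norm_times_sphere_le:
  assumes "0 \<le> p" "y \<in> nonneg_sphere"
  shows "lq_norm p (y * u) \<le> lq_norm p u"
proof (rule lq_norm_mono[OF assms(1)])
  fix i
  have "\<bar>y $ i\<bar> \<le> 1" using component_le_norm_cart[of y i] assms(2) by (simp add: nonneg_sphere_def)
  then show "\<bar>(y * u) $ i\<bar> \<le> \<bar>u $ i\<bar>" by (simp add: abs_mult mult_left_le_one_le)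
qed

lemma integrable_lq_norm_times:
  assumes "0 \<le> p" "sets \<mu> = sets (restrict_space borel nonneg_sphere)" "finite_measure \<mu>"
  shows "integrable \<mu> (\<lambda>y. lq_norm p (y * u))"
proof (rule finite_measure.integrable_const_bound[OF assms(3), of _ "lq_norm p u"])
  have "y * u = (\<chi> i. y $ i * u $ i)" for y by (simp add: vec_eq_iff)
  then have "(\<lambda>y. lq_norm p (y * u)) \<in> borel_measurable borel" by simp
  from measurable_compose[OF restrict_borel_sets_ident(1)[OF assms(2)] this]
  show "(\<lambda>y. lq_norm p (y * u)) \<in> borel_measurable \<mu>" .
  show "AE y in \<mu>. norm (lq_norm p (y * u)) \<le> lq_norm p u"
    using lq_norm_times_sphere_le[OF assms(1)]
    by (intro AE_I2) (simp add: restrict_borel_sets_ident(2)[OF assms(2)] lq_norm_nonneg)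
qed

text \<open>The normalisation of \<open>\<mu>\<close> to a probability measure and the dilation of the expectation by its
  total mass cancel, which leaves the integral of the support functions \<open>\<parallel>y * u\<parallel>\<^sub>p\<close> of the scaled
  balls.\<close>

lemma support_function_L1_zonoid:
  fixes \<mu> :: "(real ^ 'n) measure"
  assumes p: "1 < p" and sets: "sets \<mu> = sets (restrict_space borel nonneg_sphere)"
    and fin: "finite_measure \<mu>"
  shows "support_function (L1_zonoid p \<mu>) u = (\<integral>y. lq_norm p (y * u) \<partial>\<mu>)"
proof -
  interpret finite_measure \<mu> by fact
  define c where "c = measure \<mu> (space \<mu>)"
  have p0: "0 \<le> p" using order.strict_trans[of 0 1 p] p by simp
  have int: "integrable \<mu> (\<lambda>y. lq_norm p (y * u))" for u
    using integrable_lq_norm_times[OF p0 sets fin] .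
  then have [measurable]: "(\<lambda>y. lq_norm p (y * u)) \<in> borel_measurable \<mu>" for u
    by (rule borel_measurable_integrable)
  show ?thesis
  proof (cases "c = 0")
    case True
    then have "emeasure \<mu> (space \<mu>) = 0" by (simp add: c_def emeasure_eq_measure)
    then have "AE y in \<mu>. lq_norm p (y * u) = 0"
      by (intro AE_I[of _ _ "space \<mu>"]) auto
    then have "(\<integral>y. lq_norm p (y * u) \<partial>\<mu>) = 0" by (rule integral_eq_zero_AE)
    then show ?thesis using True by (simp add: L1_zonoid_def c_def support_function_def)
  next
    case False
    then have c: "c > 0" by (simp add: c_def zero_less_measure_iff measure_nonneg less_le)
    define P where "P = scale_measure (ennreal (1 / c)) \<mu>"
    define B where "B = (lq_ball (conj_exponent p) :: (real ^ 'n) set)"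
    have B: "bounded B" "B \<noteq> {}"
      unfolding B_def using conj_exponent_pos[of p] p by (simp_all add: lq_ball_bounds)
    have hX: "support_function (coord_scale y B) v = lq_norm p (y * v)" for y v
      using p by (simp add: B_def support_function_coord_scale support_function_lq_ball)
    have "P = density \<mu> (\<lambda>_. ennreal (1 / c))" by (simp add: P_def scale_measure_eq_density)
    then have intP: "integrable P (\<lambda>y. lq_norm p (y * v))"
      and intgP: "(\<integral>y. lq_norm p (y * v) \<partial>P) = (\<integral>y. lq_norm p (y * v) \<partial>\<mu>) / c" for v
      using c int by (simp_all add: integrable_real_density integral_real_density)
    have "support_function (L1_zonoid p \<mu>) u =
        support_function (set_expectation P (\<lambda>\<eta>. coord_scale \<eta> B)) (c *\<^sub>R u)"
      using False
      by (simp add: L1_zonoid_def Let_def c_def[symmetric] support_function_scale_image P_def B_def)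
    also have "\<dots> = (\<integral>y. lq_norm p (y * (c *\<^sub>R u)) \<partial>P)"
      using support_function_set_expectation[of P "\<lambda>\<eta>. coord_scale \<eta> B"] coord_scale_bounds[OF B] intP
      by (simp add: hX)
    also have "\<dots> = (\<integral>y. c * lq_norm p (y * u) \<partial>P)"
      using c p by (simp add: mult_scaleR_right lq_norm_scaleR)
    also have "\<dots> = (\<integral>y. lq_norm p (y * u) \<partial>\<mu>)" using c by (simp add: intgP)
    finally show ?thesis .
  qed
qed

section \<open>The exponent of the spectral representation\<close>

text \<open>The function \<open>\<phi>\<close> with \<open>\<chi>\<^sub>u x = \<phi> (\<parallel>x * u\<parallel>\<^sub>p)\<close> on the orthant.\<close>

definition radial_profile :: "ereal \<Rightarrow> real \<Rightarrow> real" where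
  "radial_profile p x =
    (if p = \<infinity> then (if x \<le> 1 then 1 else 0) else exp (- (x powr real_of_ereal p)))"

lemma radial_profile_measurable [measurable (raw)]:
  assumes [measurable]: "f \<in> borel_measurable M"
  shows "(\<lambda>\<omega>. radial_profile p (f \<omega>)) \<in> borel_measurable M"
  unfolding radial_profile_def by (cases "p = \<infinity>") simp_all

text \<open>The reduction of \<open>\<chi>\<^sub>u\<close> to one variable that makes the Levy integral computable.\<close>

lemma chi_fun_eq_radial_profile:
  assumes p: "0 < p" and x: "x \<in> nonneg_orthant" and u: "u \<in> nonneg_orthant"
  shows "chi_fun p u x = radial_profile p (lq_norm p (x * u))"
proof (cases p)
  case (real r)
  have "\<bar>x $ i * u $ i\<bar> = x $ i * u $ i" for i
    using x u by (simp add: nonneg_orthant_def)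
  then have "lq_norm p (x * u) powr r = (\<Sum>i\<in>UNIV. (x $ i * u $ i) powr r)"
    using p real by (simp add: lq_norm_def powr_powr sum_nonneg)
  then show ?thesis using real by (simp add: chi_fun_def radial_profile_def)
next
  case PInf
  have "lq_norm p (x * u) \<le> 1 \<longleftrightarrow> (\<forall>i. x $ i * u $ i \<le> 1)"
    using x u PInf by (subst lq_norm_def) (simp add: nonneg_orthant_def)
  then show ?thesis using PInf by (simp add: chi_fun_def radial_profile_def)
qed (use p in simp)

lemma nn_integral_powr_minus_2:
  assumes "0 < c"
  shows "(\<integral>\<^sup>+t. ennreal (t powr - 2) * indicator {c..} t \<partial>lborel) = ennreal (1 / c)"
proof -
  have "(\<integral>\<^sup>+t. ennreal (t powr - 2) * indicator {c..} t \<partial>lborel) = ennreal (0 - (- (c powr - 1)))"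
  proof (rule nn_integral_FTC_atLeast)
    show "((\<lambda>t::real. - (t powr - 1)) has_real_derivative t powr - 2) (at t)" if "c \<le> t" for t
      using DERIV_minus[OF has_real_derivative_powr[of t "- 1"]] that assms by simp
    have "((\<lambda>t::real. t powr - 1) \<longlongrightarrow> 0) at_top"
      by (rule tendsto_neg_powr) (auto simp: filterlim_ident)
    then show "((\<lambda>t::real. - (t powr - 1)) \<longlongrightarrow> 0) at_top"
      using tendsto_minus by fastforce
  qed auto
  also have "0 - (- (c powr - 1)) = 1 / c" using assms by (simp add: powr_minus_divide)
  finally show ?thesis .
qed

lemma nn_integral_exp_minus:
  assumes "0 \<le> z"
  shows "(\<integral>\<^sup>+w. ennreal (exp (- w)) * indicator {0..z} w \<partial>lborel) = ennreal (1 - exp (- z))"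
proof -
  have "(\<integral>\<^sup>+w. ennreal (exp (- w)) * indicator {0..z} w \<partial>lborel) =
      ennreal (- exp (- z) - (- exp (- 0)))"
    by (rule nn_integral_FTC_Icc) (use assms in \<open>auto intro!: derivative_eq_intros\<close>)
  then show ?thesis by simp
qed

text \<open>With \<open>1 - e\<^sup>-\<^sup>z\<close> written as the integral of \<open>e\<^sup>-\<^sup>w\<close> over \<open>0 \<le> w \<le> z\<close> and the order of
  integration exchanged, the condition \<open>w \<le> (t s)\<^sup>r\<close> becomes \<open>t \<ge> w\<^sup>1\<^sup>/\<^sup>r / s\<close>. The integral of
  \<open>t\<^sup>-\<^sup>2\<close> over this ray is \<open>s w\<^sup>-\<^sup>1\<^sup>/\<^sup>r\<close>, and what is left is Euler's integral for
  \<open>\<Gamma> (1 - 1 / r)\<close>.\<close>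

lemma radial_levy_integral_ereal:
  assumes r: "1 < r" and s: "0 < s"
  shows "(\<integral>\<^sup>+t. indicator {0<..} t * ennreal (t powr - 2) * ennreal (1 - exp (- ((t * s) powr r))) \<partial>lborel)
    = ennreal (Gamma (1 - 1 / r) * s)"
proof -
  have 1: "ennreal (1 - exp (- ((t * s) powr r))) =
      (\<integral>\<^sup>+w. ennreal (exp (- w)) * indicator {0..(t * s) powr r} w \<partial>lborel)" for t
    by (simp add: nn_integral_exp_minus)
  have ind: "indicator {0<..} t * indicator {0..(t * s) powr r} w =
      (indicator {0<..} t * indicator {0..} w * (if w \<le> (t * s) powr r then 1 else 0) :: ennreal)" for t w
    by (auto simp: indicator_def)
  have "(\<integral>\<^sup>+t. indicator {0<..} t * ennreal (t powr - 2) * ennreal (1 - exp (- ((t * s) powr r))) \<partial>lborel)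
     = (\<integral>\<^sup>+t. \<integral>\<^sup>+w. ennreal (t powr - 2) * ennreal (exp (- w)) *
          (indicator {0<..} t * indicator {0..(t * s) powr r} w) \<partial>lborel \<partial>lborel)"
    unfolding 1 by (subst nn_integral_cmult[symmetric]) (simp_all add: mult_ac)
  also have "\<dots> = (\<integral>\<^sup>+w. \<integral>\<^sup>+t. ennreal (t powr - 2) * ennreal (exp (- w)) *
          (indicator {0<..} t * indicator {0..(t * s) powr r} w) \<partial>lborel \<partial>lborel)"
    unfolding ind by (rule lborel_pair.Fubini') simp
  also have "\<dots> = (\<integral>\<^sup>+w. ennreal s * ennreal (indicator {0..} w * w powr (1 - 1 / r - 1) / exp w) \<partial>lborel)"
  proof (rule nn_integral_cong_AE, use AE_lborel_singleton[of 0] in eventually_elim)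
    fix w :: real assume "w \<noteq> 0"
    then consider "w < 0" | "w > 0" by linarith
    then show "(\<integral>\<^sup>+t. ennreal (t powr - 2) * ennreal (exp (- w)) *
          (indicator {0<..} t * indicator {0..(t * s) powr r} w) \<partial>lborel) =
        ennreal s * ennreal (indicator {0..} w * w powr (1 - 1 / r - 1) / exp w)"
    proof cases
      case 2
      define c where "c = w powr (1 / r) / s"
      have c: "c > 0" using 2 s by (simp add: c_def)
      have "w \<le> (t * s) powr r \<longleftrightarrow> c \<le> t" if "t > 0" for t
      proof -
        have "w \<le> (t * s) powr r \<longleftrightarrow> w powr (1 / r) \<le> ((t * s) powr r) powr (1 / r)"
          using 2 r powr_less_mono2[of "1 / r" "(t * s) powr r" w]
            powr_mono2[of "1 / r" w "(t * s) powr r"]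
          by (cases "w \<le> (t * s) powr r") auto
        then show ?thesis using that s r by (simp add: powr_powr c_def field_simps)
      qed
      then have "indicator {0<..} t * indicator {0..(t * s) powr r} w = (indicator {c..} t :: ennreal)" for t
        using 2 c by (auto simp: indicator_def)
      then have "(\<integral>\<^sup>+t. ennreal (t powr - 2) * ennreal (exp (- w)) *
          (indicator {0<..} t * indicator {0..(t * s) powr r} w) \<partial>lborel) =
          (\<integral>\<^sup>+t. ennreal (exp (- w)) * (ennreal (t powr - 2) * indicator {c..} t) \<partial>lborel)"
        by (simp add: mult_ac)
      also have "\<dots> = ennreal (exp (- w)) * ennreal (1 / c)"
        by (subst nn_integral_cmult) (simp_all add: nn_integral_powr_minus_2 c)
      also have "\<dots> = ennreal s * ennreal (indicator {0..} w * w powr (1 - 1 / r - 1) / exp w)"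
        using 2 s by (simp add: ennreal_mult'[symmetric] c_def powr_minus_divide exp_minus field_simps)
      finally show ?thesis .
    qed simp
  qed
  also have "\<dots> = ennreal s * ennreal (Gamma (1 - 1 / r))"
    using r by (subst nn_integral_cmult) (simp_all add: Gamma_conv_nn_integral_real)
  finally show ?thesis
    using s r by (simp add: ennreal_mult'[symmetric] mult.commute)
qed

lemma radial_levy_integral_infinity:
  assumes s: "0 < s"
  shows "(\<integral>\<^sup>+t. indicator {0<..} t * ennreal (t powr - 2) * (if t * s \<le> 1 then 0 else 1) \<partial>lborel) = ennreal s"
proof -
  have "(\<integral>\<^sup>+t. indicator {0<..} t * ennreal (t powr - 2) * (if t * s \<le> 1 then 0 else 1) \<partial>lborel) =
      (\<integral>\<^sup>+t. ennreal (t powr - 2) * indicator {1 / s..} t \<partial>lborel)"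
  proof (rule nn_integral_cong_AE, use AE_lborel_singleton[of "1 / s"] in eventually_elim)
    fix t :: real assume t: "t \<noteq> 1 / s"
    define c where "c = 1 / s"
    have "t * s \<le> 1 \<longleftrightarrow> t \<le> c" "0 < c" "t \<noteq> c"
      using s t by (simp_all add: c_def field_simps)
    then show "indicator {0<..} t * ennreal (t powr - 2) * (if t * s \<le> 1 then 0 else 1) =
        ennreal (t powr - 2) * indicator {1 / s..} t"
      unfolding c_def[symmetric] by (auto simp: indicator_def)
  qed
  also have "\<dots> = ennreal s" using s by (simp add: nn_integral_powr_minus_2)
  finally show ?thesis .
qed

lemma real_of_ereal_inverse_ereal: "real_of_ereal (1 / ereal r) = 1 / r"
  by (cases "r = 0") (simp_all add: one_ereal_def)

lemma radial_levy_integral: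
  assumes p: "1 < p" and s: "0 \<le> s"
  shows "(\<integral>\<^sup>+t. indicator {0<..} t * ennreal (t powr - 2) * ennreal (1 - radial_profile p (t * s)) \<partial>lborel)
    = ennreal (Gamma (1 - real_of_ereal (1 / p)) * s)"
proof (cases "s = 0")
  case True
  then show ?thesis by (simp add: radial_profile_def)
next
  case False
  with s have s: "0 < s" by simp
  show ?thesis
  proof (cases p)
    case (real r)
    then show ?thesis
      using radial_levy_integral_ereal[of r s] p s
      by (simp add: radial_profile_def real_of_ereal_inverse_ereal)
  next
    case PInf
    have "ennreal (1 - radial_profile p x) = (if x \<le> 1 then 0 else 1)" for x
      using PInf by (simp add: radial_profile_def)
    then show ?thesis using radial_levy_integral_infinity[OF s] PInf by simp
  qed (use p in simp)
qed

lemma Gamma_one_minus_inverse_pos: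
  assumes "1 < p"
  shows "0 < Gamma (1 - real_of_ereal (1 / p))"
  using assms by (cases p) (auto intro!: Gamma_real_pos simp: real_of_ereal_inverse_ereal)

lemma chi_fun_bounds: "0 \<le> chi_fun p u x" "chi_fun p u x \<le> 1"
  by (auto simp: chi_fun_def sum_nonneg)

lemma chi_fun_measurable [measurable (raw)]:
  fixes f :: "'w \<Rightarrow> real ^ 'n"
  assumes [measurable]: "f \<in> borel_measurable M"
  shows "(\<lambda>\<omega>. chi_fun p u (f \<omega>)) \<in> borel_measurable M"
  unfolding chi_fun_def by (cases "p = \<infinity>") simp_all

text \<open>Tonelli's theorem in polar coordinates: the integral along each ray is linear in
  \<open>\<parallel>y * u\<parallel>\<^sub>p\<close>.\<close>

lemma levy_integral:
  fixes \<sigma> :: "(real ^ 'n) measure"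
  assumes p: "1 < p" and sets: "sets \<sigma> = sets (restrict_space borel nonneg_sphere)"
    and fin: "finite_measure \<sigma>" and u: "u \<in> nonneg_orthant"
  shows "(\<integral>x. (1 - chi_fun p u x) \<partial>levy_measure 1 \<sigma>) =
    Gamma (1 - real_of_ereal (1 / p)) * (\<integral>y. lq_norm p (y * u) \<partial>\<sigma>)"
proof -
  interpret \<sigma>: finite_measure \<sigma> by fact
  have p0: "0 < p" using order.strict_trans[of 0 1 p] p by simp
  define g where "g = Gamma (1 - real_of_ereal (1 / p))"
  have g: "g > 0" unfolding g_def by (rule Gamma_one_minus_inverse_pos[OF p])
  \<comment> \<open>The radial density of the Levy measure for \<open>\<alpha> = 1\<close>.\<close>
  define d :: "real \<Rightarrow> ennreal" where "d t = indicator {0<..} t * ennreal (t powr - 2)" for t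
  have [measurable]: "d \<in> borel_measurable borel" unfolding d_def by measurable
  interpret N: sigma_finite_measure "density lborel d"
    by (subst sigma_finite_measure.sigma_finite_iff_density_finite'[OF lborel.sigma_finite_measure_axioms])
      (auto simp: d_def indicator_def)
  interpret NS: pair_sigma_finite "density lborel d" \<sigma> ..
  have snd_m: "snd \<in> borel_measurable (density lborel d \<Otimes>\<^sub>M \<sigma>)"
    by (rule measurable_compose[OF measurable_snd restrict_borel_sets_ident(1)[OF sets]])
  have fst_m: "fst \<in> borel_measurable (density lborel d \<Otimes>\<^sub>M \<sigma>)"
    by (rule measurable_compose[OF measurable_fst]) simp
  have polar: "(\<lambda>(t, y). t *\<^sub>R y) \<in> borel_measurable (density lborel d \<Otimes>\<^sub>M \<sigma>)"
    using borel_measurable_scaleR[OF fst_m snd_m] by (simp add: split_beta')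
  define f where "f = (\<lambda>(t, y). 1 - chi_fun p u (t *\<^sub>R y) :: real)"
  have f: "f \<in> borel_measurable (density lborel d \<Otimes>\<^sub>M \<sigma>)"
    using measurable_compose[OF polar, of "\<lambda>x. 1 - chi_fun p u x" borel]
    by (simp add: f_def split_beta')
  have f_nonneg: "0 \<le> f z" for z
    by (simp add: f_def split_beta' chi_fun_bounds)
  have sphere: "y \<in> nonneg_orthant" if "y \<in> space \<sigma>" for y
    using that by (simp add: restrict_borel_sets_ident(2)[OF sets] nonneg_sphere_def)
  have "(\<integral>x. (1 - chi_fun p u x) \<partial>levy_measure 1 \<sigma>) = (\<integral>z. f z \<partial>(density lborel d \<Otimes>\<^sub>M \<sigma>))"
    unfolding levy_measure_def
    by (subst integral_distr) (use polar in \<open>simp_all add: f_def d_def[abs_def] split_beta'\<close>)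
  also have "\<dots> = enn2real (\<integral>\<^sup>+z. ennreal (f z) \<partial>(density lborel d \<Otimes>\<^sub>M \<sigma>))"
    using f f_nonneg by (intro integral_eq_nn_integral) auto
  also have "(\<integral>\<^sup>+z. ennreal (f z) \<partial>(density lborel d \<Otimes>\<^sub>M \<sigma>)) =
      (\<integral>\<^sup>+y. \<integral>\<^sup>+t. ennreal (f (t, y)) \<partial>density lborel d \<partial>\<sigma>)"
    using f by (intro NS.nn_integral_snd[symmetric]) auto
  also have "\<dots> = (\<integral>\<^sup>+y. ennreal (g * lq_norm p (y * u)) \<partial>\<sigma>)"
  proof (rule nn_integral_cong)
    fix y assume "y \<in> space \<sigma>"
    note y = sphere[OF this]
    have "(\<integral>\<^sup>+t. ennreal (f (t, y)) \<partial>density lborel d) = (\<integral>\<^sup>+t. d t * ennreal (f (t, y)) \<partial>lborel)"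
      by (rule nn_integral_density) (simp_all add: f_def)
    also have "\<dots> = (\<integral>\<^sup>+t. d t * ennreal (1 - radial_profile p (t * lq_norm p (y * u))) \<partial>lborel)"
    proof (rule nn_integral_cong)
      fix t :: real
      show "d t * ennreal (f (t, y)) = d t * ennreal (1 - radial_profile p (t * lq_norm p (y * u)))"
      proof (cases "t > 0")
        case True
        then have "t *\<^sub>R y \<in> nonneg_orthant" using y by (simp add: nonneg_orthant_def)
        from chi_fun_eq_radial_profile[OF p0 this u] show ?thesis
          using p True by (simp add: f_def mult_scaleR_left lq_norm_scaleR)
      qed (simp add: d_def)
    qed
    also have "\<dots> = ennreal (g * lq_norm p (y * u))"
      unfolding d_def g_def by (rule radial_levy_integral[OF p lq_norm_nonneg])
    finally show "(\<integral>\<^sup>+t. ennreal (f (t, y)) \<partial>density lborel d) = ennreal (g * lq_norm p (y * u))" .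
  qed
  also have "\<dots> = ennreal (\<integral>y. g * lq_norm p (y * u) \<partial>\<sigma>)"
    using p0 g integrable_lq_norm_times[OF _ sets fin]
    by (intro nn_integral_eq_integral) (auto simp: lq_norm_nonneg less_imp_le)
  finally show ?thesis
    using g by (simp add: g_def lq_norm_nonneg)
qed

section \<open>The transform determines the law\<close>

text \<open>The indicator of a closed set \<open>C\<close> is the limit of the tent functions
  \<open>max 0 (1 - n d(x, C))\<close>, and the closed sets form a generator of the Borel sets that is stable under
  intersection. The hypothesis ranges over unbounded functions too: it is meant for measures with
  compact support.\<close>

lemma measure_eqI_continuous_integrals:
  fixes \<mu> \<nu> :: "('a :: euclidean_space) measure"
  assumes "finite_measure \<mu>" "finite_measure \<nu>"
    and sets [measurable_cong]: "sets \<mu> = sets borel" "sets \<nu> = sets borel"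
    and eq: "\<And>f :: 'a \<Rightarrow> real. continuous_on UNIV f \<Longrightarrow> integral\<^sup>L \<mu> f = integral\<^sup>L \<nu> f"
  shows "\<mu> = \<nu>"
proof -
  interpret \<mu>: finite_measure \<mu> by fact
  interpret \<nu>: finite_measure \<nu> by fact
  have closed_eq: "emeasure \<mu> C = emeasure \<nu> C" if C: "closed C" for C
  proof (cases "C = {}")
    case False
    define f where "f n x = max 0 (1 - real n * infdist x C)" for n x
    have cont: "continuous_on UNIV (f n)" for n
      unfolding f_def by (intro continuous_intros)
    have [measurable]: "f n \<in> borel_measurable borel" for n
      by (rule borel_measurable_continuous_onI[OF cont])
    have [measurable]: "C \<in> sets borel" using C by simp
    have bound: "norm (f n x) \<le> 1" for n x by (simp add: f_def infdist_nonneg)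
    have lim: "(\<lambda>n. f n x) \<longlonglongrightarrow> indicator C x" for x
    proof (cases "x \<in> C")
      case True
      then show ?thesis by (simp add: f_def)
    next
      case x: False
      then have d: "infdist x C > 0" by (rule infdist_pos_not_in_closed[OF C False])
      have "f n x = 0" if "n \<ge> nat \<lceil>1 / infdist x C\<rceil>" for n
      proof -
        have "1 / infdist x C \<le> real n" using that by linarith
        then show ?thesis using d by (simp add: f_def field_simps)
      qed
      then have "\<forall>\<^sub>F n in sequentially. f n x = 0" by (rule eventually_sequentiallyI)
      then show ?thesis using x by (simp add: tendsto_eventually)
    qed
    have "(\<lambda>n. integral\<^sup>L \<mu> (f n)) \<longlonglongrightarrow> (\<integral>x. indicator C x \<partial>\<mu>)"
      "(\<lambda>n. integral\<^sup>L \<nu> (f n)) \<longlonglongrightarrow> (\<integral>x. indicator C x \<partial>\<nu>)"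
      by (rule integral_dominated_convergence[where w="\<lambda>_. 1"]; use lim bound in simp)+
    then have "(\<integral>x. indicator C x \<partial>\<mu>) = (\<integral>x. indicator C x \<partial>\<nu> :: real)"
      using LIMSEQ_unique by (simp add: eq[OF cont])
    then show ?thesis
      using sets_eq_imp_space_eq[OF sets(1)] sets_eq_imp_space_eq[OF sets(2)]
      by (simp add: \<mu>.emeasure_eq_measure \<nu>.emeasure_eq_measure)
  qed simp
  show ?thesis
  proof (rule measure_eqI_generator_eq[where E="Collect closed" and \<Omega>=UNIV and A="\<lambda>_. UNIV"])
    show "Int_stable (Collect closed :: 'a set set)" by (auto simp: Int_stable_def)
    have "sets (borel :: 'a measure) = sigma_sets UNIV (Collect closed)"
      by (simp add: borel_eq_closed)
    then show "sets \<mu> = sigma_sets UNIV (Collect closed)" "sets \<nu> = sigma_sets UNIV (Collect closed)"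
      by (simp_all add: sets)
  qed (auto intro: closed_eq)
qed

text \<open>Polynomial functions are generated by sums and products, and equality of integrals does not
  pass to products. The class \<open>V\<close> of functions whose products with every monomial have equal
  integrals repairs this: it is closed under multiplication by a coordinate, hence by every polynomial,
  and it contains the constant \<open>1\<close>.\<close>

lemma integral_monomials_imp_polynomials:
  fixes \<mu> \<nu> :: "(real ^ 'n) measure"
  assumes int: "\<And>h :: real ^ 'n \<Rightarrow> real. continuous_on UNIV h \<Longrightarrow> integrable \<mu> h"
      "\<And>h :: real ^ 'n \<Rightarrow> real. continuous_on UNIV h \<Longrightarrow> integrable \<nu> h"
    and moments: "\<And>k :: 'n \<Rightarrow> nat. (\<integral>x. (\<Prod>i\<in>UNIV. x $ i ^ k i) \<partial>\<mu>) = (\<integral>x. (\<Prod>i\<in>UNIV. x $ i ^ k i) \<partial>\<nu>)"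
    and f: "real_polynomial_function f"
  shows "integral\<^sup>L \<mu> f = integral\<^sup>L \<nu> f"
proof -
  define V where "V = {g :: real ^ 'n \<Rightarrow> real. continuous_on UNIV g \<and>
    (\<forall>k. (\<integral>x. (\<Prod>i\<in>UNIV. x $ i ^ k i) * g x \<partial>\<mu>) = (\<integral>x. (\<Prod>i\<in>UNIV. x $ i ^ k i) * g x \<partial>\<nu>))}"
  have mono_cont: "continuous_on UNIV (\<lambda>x :: real ^ 'n. \<Prod>i\<in>UNIV. x $ i ^ k i)" for k
    by (intro continuous_intros)
  have V_add: "(\<lambda>x. g x + h x) \<in> V" if "g \<in> V" "h \<in> V" for g h
    using that int by (auto simp: V_def distrib_left continuous_intros mono_cont)
  have V_const: "(\<lambda>x. c * g x) \<in> V" if "g \<in> V" for g c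
    using that by (auto simp: V_def mult.left_commute[of _ c] continuous_intros)
  have V_coord: "(\<lambda>x. x $ j * g x) \<in> V" if g: "g \<in> V" for g j
  proof -
    \<comment> \<open>The coordinate is absorbed into the monomial.\<close>
    have shift: "(\<Prod>i\<in>UNIV. x $ i ^ k i) * (x $ j * g x) = (\<Prod>i\<in>UNIV. x $ i ^ (k(j := Suc (k j))) i) * g x"
      for k and x :: "real ^ 'n"
      by (simp add: prod.remove[of UNIV j] mult_ac)
    have "(\<integral>x. (\<Prod>i\<in>UNIV. x $ i ^ k i) * (x $ j * g x) \<partial>\<mu>) =
        (\<integral>x. (\<Prod>i\<in>UNIV. x $ i ^ k i) * (x $ j * g x) \<partial>\<nu>)" for k
      using g unfolding shift V_def by blast
    then show ?thesis using g by (simp add: V_def continuous_intros)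
  qed
  have V_sum: "(\<lambda>x. \<Sum>i\<in>I. h i x) \<in> V" if "finite I" "\<And>i. i \<in> I \<Longrightarrow> h i \<in> V" for I :: "'n set" and h
    using that
  proof (induction I)
    case empty
    then show ?case by (simp add: V_def)
  next
    case (insert i I)
    then show ?case by (simp add: V_add)
  qed
  have mult_V: "(\<lambda>x. f x * g x) \<in> V" if "g \<in> V" for g
    using f that
  proof (induction f arbitrary: g)
    case (linear f)
    interpret bounded_linear f by fact
    have expand: "f x * g x = (\<Sum>i\<in>UNIV. f (axis i 1) * (x $ i * g x))" for x
    proof -
      have "f x = f (\<Sum>i\<in>UNIV. x $ i *\<^sub>R axis i 1)"
        using basis_expansion[of x] by (simp add: scalar_mult_eq_scaleR)
      also have "\<dots> = (\<Sum>i\<in>UNIV. x $ i * f (axis i 1))" by (simp add: sum scale)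
      finally show ?thesis by (simp add: sum_distrib_left sum_distrib_right mult_ac)
    qed
    have "(\<lambda>x. f (axis i 1) * (x $ i * g x)) \<in> V" for i
      by (rule V_const[OF V_coord[OF linear.prems]])
    from V_sum[OF finite_class.finite_UNIV this] show ?case by (simp add: expand)
  next
    case (const c)
    then show ?case by (rule V_const)
  next
    case (add f1 f2)
    then show ?case using V_add by (simp add: distrib_right)
  next
    case (mult f1 f2)
    then show ?case by (simp add: mult.assoc)
  qed
  have "(\<lambda>_. 1) \<in> V" using moments by (simp add: V_def)
  from mult_V[OF this] have "f \<in> V" by simp
  \<comment> \<open>The claim is the case of the monomial of order \<open>0\<close>.\<close>
  then show ?thesis unfolding V_def by (auto dest: spec[where x="\<lambda>_. 0"])
qed

text \<open>On \<open>K\<close> a continuous function is within \<open>e\<close> of a polynomial, so the integrals of the function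
  against \<open>\<mu>\<close> and \<open>\<nu>\<close> differ by at most \<open>e\<close> times the total mass of both measures, for every
  \<open>e > 0\<close>.\<close>

lemma compact_support_determined_by_moments:
  fixes \<mu> \<nu> :: "(real ^ 'n) measure"
  assumes "finite_measure \<mu>" "finite_measure \<nu>"
    and sets [measurable_cong]: "sets \<mu> = sets borel" "sets \<nu> = sets borel"
    and K: "compact K" "AE x in \<mu>. x \<in> K" "AE x in \<nu>. x \<in> K"
    and moments: "\<And>k :: 'n \<Rightarrow> nat. (\<integral>x. (\<Prod>i\<in>UNIV. x $ i ^ k i) \<partial>\<mu>) = (\<integral>x. (\<Prod>i\<in>UNIV. x $ i ^ k i) \<partial>\<nu>)"
  shows "\<mu> = \<nu>"
proof (rule measure_eqI_continuous_integrals[OF assms(1-4)])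
  interpret \<mu>: finite_measure \<mu> by fact
  interpret \<nu>: finite_measure \<nu> by fact
  have bounded_on_K: "\<exists>B. \<forall>x\<in>K. norm (h x) \<le> B"
    if "continuous_on UNIV h" for h :: "real ^ 'n \<Rightarrow> real"
    using compact_imp_bounded[OF compact_continuous_image[OF continuous_on_subset[OF that] K(1)]]
    by (auto simp: bounded_iff)
  have int: "integrable \<mu> h" "integrable \<nu> h" if h: "continuous_on UNIV h" for h :: "real ^ 'n \<Rightarrow> real"
  proof -
    have [measurable]: "h \<in> borel_measurable borel" by (rule borel_measurable_continuous_onI[OF h])
    obtain B where B: "\<forall>x\<in>K. norm (h x) \<le> B" using bounded_on_K[OF h] by blast
    show "integrable \<mu> h"
      by (rule \<mu>.integrable_const_bound[of _ B]) (use K(2) B in auto)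
    show "integrable \<nu> h"
      by (rule \<nu>.integrable_const_bound[of _ B]) (use K(3) B in auto)
  qed
  fix h :: "real ^ 'n \<Rightarrow> real" assume h: "continuous_on UNIV h"
  define D where "D = integral\<^sup>L \<mu> h - integral\<^sup>L \<nu> h"
  define m where "m = measure \<mu> (space \<mu>) + measure \<nu> (space \<nu>)"
  have m: "m \<ge> 0" by (simp add: m_def)
  have D: "\<bar>D\<bar> \<le> e * m" if e: "e > 0" for e
  proof -
    obtain g where g: "real_polynomial_function g" "\<And>x. x \<in> K \<Longrightarrow> \<bar>h x - g x\<bar> < e"
      using Stone_Weierstrass_real_polynomial_function[OF K(1) continuous_on_subset[OF h] e] by auto
    have g_cont: "continuous_on UNIV g"
      using g(1) by (simp add: continuous_on_polymonial_function real_polynomial_function_eq)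
    have eq: "integral\<^sup>L \<mu> g = integral\<^sup>L \<nu> g"
      by (rule integral_monomials_imp_polynomials[OF int moments g(1)])
    have approx: "\<bar>integral\<^sup>L \<kappa> h - integral\<^sup>L \<kappa> g\<bar> \<le> e * measure \<kappa> (space \<kappa>)"
      if \<kappa>: "finite_measure \<kappa>" "AE x in \<kappa>. x \<in> K"
        and int: "\<And>f :: real ^ 'n \<Rightarrow> real. continuous_on UNIV f \<Longrightarrow> integrable \<kappa> f" for \<kappa>
    proof -
      interpret finite_measure \<kappa> by fact
      have "\<bar>integral\<^sup>L \<kappa> h - integral\<^sup>L \<kappa> g\<bar> = \<bar>\<integral>x. h x - g x \<partial>\<kappa>\<bar>"
        by (simp add: int h g_cont)
      also have "\<dots> \<le> (\<integral>x. \<bar>h x - g x\<bar> \<partial>\<kappa>)" by (rule integral_abs_bound)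
      also have "\<dots> \<le> (\<integral>x. e \<partial>\<kappa>)"
      proof (rule integral_mono_AE)
        show "integrable \<kappa> (\<lambda>x. \<bar>h x - g x\<bar>)"
          by (intro int continuous_intros h g_cont)
        show "AE x in \<kappa>. \<bar>h x - g x\<bar> \<le> e" using \<kappa>(2) g(2) by (auto intro: less_imp_le)
      qed simp
      finally show ?thesis by (simp add: mult.commute)
    qed
    have "\<bar>D\<bar> \<le> \<bar>integral\<^sup>L \<mu> h - integral\<^sup>L \<mu> g\<bar> + \<bar>integral\<^sup>L \<nu> h - integral\<^sup>L \<nu> g\<bar>"
      using eq by (simp add: D_def)
    also have "\<dots> \<le> e * m"
      using approx[OF assms(1) K(2) int(1)] approx[OF assms(2) K(3) int(2)]
      by (simp add: m_def distrib_left)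
    finally show ?thesis .
  qed
  have "D = 0"
  proof (rule ccontr)
    assume "D \<noteq> 0"
    \<comment> \<open>The denominator \<open>m + 1\<close> makes the factor \<open>m / (m + 1)\<close> smaller than \<open>1\<close>, also for \<open>m = 0\<close>.\<close>
    then have "\<bar>D\<bar> \<le> \<bar>D\<bar> / (m + 1) * m" using m by (intro D) simp
    then show False using \<open>D \<noteq> 0\<close> m by (simp add: field_simps)
  qed
  then show "integral\<^sup>L \<mu> h = integral\<^sup>L \<nu> h" by (simp add: D_def)
qed

lemma borel_space_UNIV: "sets \<mu> = sets borel \<Longrightarrow> space \<mu> = UNIV"
  using sets_eq_imp_space_eq[of \<mu> borel] by simp

text \<open>The map \<open>\<Phi>\<close> is injective on the orthant, with inverse \<open>\<Psi>\<close>, so the measures may be compared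
  after transport to the cube, where the transform at \<open>u\<^sub>i = k\<^sub>i\<^sup>1\<^sup>/\<^sup>r\<close> is the moment of order
  \<open>k\<close>.\<close>

lemma laplace_transform_determines:
  fixes \<mu> \<nu> :: "(real ^ 'n) measure"
  assumes r: "0 < r" and "finite_measure \<mu>" "finite_measure \<nu>"
    and sets [measurable_cong]: "sets \<mu> = sets borel" "sets \<nu> = sets borel"
    and supp: "AE x in \<mu>. x \<in> nonneg_orthant" "AE x in \<nu>. x \<in> nonneg_orthant"
    and eq: "\<And>u. u \<in> nonneg_orthant \<Longrightarrow>
      (\<integral>x. exp (- (\<Sum>i\<in>UNIV. (x $ i * u $ i) powr r)) \<partial>\<mu>) =
      (\<integral>x. exp (- (\<Sum>i\<in>UNIV. (x $ i * u $ i) powr r)) \<partial>\<nu>)"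
  shows "\<mu> = \<nu>"
proof -
  interpret \<mu>: finite_measure \<mu> by fact
  interpret \<nu>: finite_measure \<nu> by fact
  define \<Phi> :: "real ^ 'n \<Rightarrow> real ^ 'n" where "\<Phi> x = (\<chi> i. exp (- (x $ i powr r)))" for x
  define \<Psi> :: "real ^ 'n \<Rightarrow> real ^ 'n" where "\<Psi> y = (\<chi> i. (- ln (y $ i)) powr (1 / r))" for y
  have [measurable]: "\<Phi> \<in> borel_measurable borel" "\<Psi> \<in> borel_measurable borel"
    by (simp_all add: \<Phi>_def[abs_def] \<Psi>_def[abs_def])
  have \<Phi>: "\<Phi> x \<in> {0..1}" for x
    by (simp add: \<Phi>_def less_eq_vec_def)
  have moment: "(\<Prod>i\<in>UNIV. \<Phi> x $ i ^ k i) =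
      exp (- (\<Sum>i\<in>UNIV. (x $ i * (\<chi> i. real (k i) powr (1 / r)) $ i) powr r))" for x k
    using r by (simp add: \<Phi>_def exp_sum[symmetric] exp_of_nat_mult[symmetric] sum_negf[symmetric]
        powr_mult powr_powr mult.commute)
  have "distr \<mu> borel \<Phi> = distr \<nu> borel \<Phi>"
  proof (rule compact_support_determined_by_moments[where K="{0..1}"])
    show "finite_measure (distr \<mu> borel \<Phi>)" "finite_measure (distr \<nu> borel \<Phi>)"
      by (rule \<mu>.finite_measure_distr \<nu>.finite_measure_distr; simp)+
    show "compact {0..1 :: real ^ 'n}" using compact_cbox[of "0 :: real ^ 'n" 1] by (simp add: interval_cbox)
    show "AE x in distr \<mu> borel \<Phi>. x \<in> {0..1}" "AE x in distr \<nu> borel \<Phi>. x \<in> {0..1}"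
      using \<Phi> by (simp_all add: AE_distr_iff)
    show "(\<integral>x. (\<Prod>i\<in>UNIV. x $ i ^ k i) \<partial>distr \<mu> borel \<Phi>) =
        (\<integral>x. (\<Prod>i\<in>UNIV. x $ i ^ k i) \<partial>distr \<nu> borel \<Phi>)" for k
    proof -
      have "(\<chi> i. real (k i) powr (1 / r)) \<in> (nonneg_orthant :: (real ^ 'n) set)"
        by (simp add: nonneg_orthant_def)
      from eq[OF this] have "(\<integral>x. (\<Prod>i\<in>UNIV. \<Phi> x $ i ^ k i) \<partial>\<mu>) = (\<integral>x. (\<Prod>i\<in>UNIV. \<Phi> x $ i ^ k i) \<partial>\<nu>)"
        by (simp only: moment)
      then show ?thesis by (subst (1 2) integral_distr) simp_all
    qed
  qed simp_all
  then have "distr (distr \<mu> borel \<Phi>) borel \<Psi> = distr (distr \<nu> borel \<Phi>) borel \<Psi>" by simp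
  then have *: "distr \<mu> borel (\<Psi> \<circ> \<Phi>) = distr \<nu> borel (\<Psi> \<circ> \<Phi>)" by (simp add: distr_distr)
  have inv: "\<Psi> (\<Phi> x) = x" if "x \<in> nonneg_orthant" for x
    using that r by (simp add: \<Psi>_def \<Phi>_def vec_eq_iff powr_powr nonneg_orthant_def)
  have id: "distr \<kappa> borel (\<Psi> \<circ> \<Phi>) = \<kappa>"
    if \<kappa>: "sets \<kappa> = sets borel" "AE x in \<kappa>. x \<in> nonneg_orthant" for \<kappa>
  proof -
    have "AE x in \<kappa>. (\<Psi> \<circ> \<Phi>) x = x" using \<kappa>(2) by eventually_elim (simp add: inv)
    moreover have "\<Psi> \<circ> \<Phi> \<in> borel_measurable \<kappa>" "(\<lambda>x. x) \<in> borel_measurable \<kappa>"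
      by (simp_all add: measurable_cong_sets[OF \<kappa>(1) refl])
    ultimately have "distr \<kappa> borel (\<Psi> \<circ> \<Phi>) = distr \<kappa> borel (\<lambda>x. x)"
      by (intro distr_cong_AE refl)
    then show ?thesis by (simp add: distr_id2 \<kappa>(1))
  qed
  show ?thesis using * by (simp add: id sets supp)
qed

text \<open>The sets \<open>{..c}\<close> generate the Borel sets and are stable under intersection. Those with a
  negative coordinate of \<open>c\<close> are null, and the others are decreasing limits of sets with positive
  \<open>c\<close>, so strictly positive \<open>c\<close> suffice.\<close>

lemma distribution_function_determines:
  fixes \<mu> \<nu> :: "(real ^ 'n) measure"
  assumes "finite_measure \<mu>" "finite_measure \<nu>"
    and sets [measurable_cong]: "sets \<mu> = sets borel" "sets \<nu> = sets borel"
    and supp: "AE x in \<mu>. x \<in> nonneg_orthant" "AE x in \<nu>. x \<in> nonneg_orthant"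
    and eq: "\<And>c. (\<And>i. 0 < c $ i) \<Longrightarrow> measure \<mu> {..c} = measure \<nu> {..c}"
  shows "\<mu> = \<nu>"
proof -
  interpret \<mu>: finite_measure \<mu> by fact
  interpret \<nu>: finite_measure \<nu> by fact
  have [measurable]: "{..c} \<in> sets borel" for c :: "real ^ 'n" by simp
  have eq': "measure \<mu> {..c} = measure \<nu> {..c}" for c
  proof (cases "\<forall>i. 0 \<le> c $ i")
    case True
    define d where "d n = c + (\<chi> i. inverse (real (Suc n)))" for n
    have d: "measure \<mu> {..d n} = measure \<nu> {..d n}" for n
      using True by (intro eq) (simp add: d_def add_nonneg_pos)
    have dec: "decseq (\<lambda>n. {..d n})"
      by (auto simp: decseq_def d_def less_eq_vec_def elim!: order_trans
          intro!: le_imp_inverse_le add_left_mono)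
    have "(\<lambda>n. d n $ i) \<longlonglongrightarrow> c $ i + 0" for i
      unfolding d_def vector_add_component vec_lambda_beta
      by (intro tendsto_add tendsto_const LIMSEQ_inverse_real_of_nat)
    then have "x $ i \<le> c $ i" if "\<forall>n. x \<le> d n" for x i
      using that LIMSEQ_le_const[of "\<lambda>n. d n $ i" "c $ i" "x $ i"] by (auto simp: less_eq_vec_def)
    moreover have "x \<le> d n" if "x \<le> c" for x n
      using that by (auto simp: d_def less_eq_vec_def intro: add_increasing2)
    ultimately have INT: "(\<Inter>n. {..d n}) = {..c}" by (auto simp: less_eq_vec_def)
    have "(\<lambda>n. measure \<mu> {..d n}) \<longlonglongrightarrow> measure \<mu> {..c}" "(\<lambda>n. measure \<nu> {..d n}) \<longlonglongrightarrow> measure \<nu> {..c}"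
      using \<mu>.finite_Lim_measure_decseq[OF _ dec] \<nu>.finite_Lim_measure_decseq[OF _ dec]
      by (simp_all add: INT sets image_subset_iff)
    then show ?thesis using d LIMSEQ_unique by simp
  next
    case False
    then obtain i where i: "c $ i < 0" by (auto simp: not_le)
    have out: "x \<notin> {..c}" if "x \<in> nonneg_orthant" for x
    proof
      assume "x \<in> {..c}"
      then have "x $ i \<le> c $ i" by (simp add: less_eq_vec_def)
      moreover have "0 \<le> x $ i" using that by (simp add: nonneg_orthant_def)
      ultimately show False using i by simp
    qed
    have "AE x in \<mu>. x \<notin> {..c}" "AE x in \<nu>. x \<notin> {..c}" using supp out by auto
    then have "emeasure \<mu> {..c} = 0" "emeasure \<nu> {..c} = 0"
      by (simp_all add: AE_iff_measurable[OF _ refl] borel_space_UNIV sets atMost_def)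
    then show ?thesis by (simp add: measure_def)
  qed
  show ?thesis
  proof (rule measure_eqI_generator_eq[where E="range atMost" and \<Omega>=UNIV
        and A="\<lambda>n. {..\<chi> i. real n}"])
    show "Int_stable (range atMost :: (real ^ 'n) set set)"
    proof (rule Int_stableI)
      fix A B :: "(real ^ 'n) set" assume "A \<in> range atMost" "B \<in> range atMost"
      then obtain a b where "A = {..a}" "B = {..b}" by auto
      then have "A \<inter> B = {..inf a b}" by auto
      then show "A \<inter> B \<in> range atMost" by blast
    qed
    have "sets (borel :: (real ^ 'n) measure) = sigma_sets UNIV (range atMost)"
      by (subst borel_eq_atMost) simp
    then show "sets \<mu> = sigma_sets UNIV (range atMost)" "sets \<nu> = sigma_sets UNIV (range atMost)"
      by (simp_all add: sets)
    show "emeasure \<mu> X = emeasure \<nu> X" if "X \<in> range atMost" for X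
      using that eq' by (auto simp: \<mu>.emeasure_eq_measure \<nu>.emeasure_eq_measure)
    have "x \<in> {..(\<chi> i. real (nat \<lceil>norm x\<rceil>))}" for x :: "real ^ 'n"
    proof -
      have "x $ i \<le> real (nat \<lceil>norm x\<rceil>)" for i
        using component_le_norm_cart[of x i] by linarith
      then show ?thesis by (simp add: less_eq_vec_def)
    qed
    then show "(\<Union>n. {..\<chi> i. real n}) = (UNIV :: (real ^ 'n) set)" by blast
  qed auto
qed

lemma chi_fun_determines:
  fixes \<mu> \<nu> :: "(real ^ 'n) measure"
  assumes p: "0 < p" and fin: "finite_measure \<mu>" "finite_measure \<nu>"
    and sets: "sets \<mu> = sets borel" "sets \<nu> = sets borel"
    and supp: "AE x in \<mu>. x \<in> nonneg_orthant" "AE x in \<nu>. x \<in> nonneg_orthant"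
    and eq: "\<And>u. u \<in> nonneg_orthant \<Longrightarrow> integral\<^sup>L \<mu> (chi_fun p u) = integral\<^sup>L \<nu> (chi_fun p u)"
  shows "\<mu> = \<nu>"
proof (cases p)
  case (real r)
  have "chi_fun p u = (\<lambda>x. exp (- (\<Sum>i\<in>UNIV. (x $ i * u $ i) powr r)))" for u :: "real ^ 'n"
    using real by (simp add: chi_fun_def fun_eq_iff)
  then show ?thesis
    using p real eq by (intro laplace_transform_determines[OF _ fin sets supp, of r]) auto
next
  case PInf
  show ?thesis
  proof (rule distribution_function_determines[OF fin sets supp])
    fix c :: "real ^ 'n" assume c: "\<And>i. 0 < c $ i"
    \<comment> \<open>With \<open>u\<^sub>i = 1 / c\<^sub>i\<close> the function \<open>\<chi>\<^sub>u\<close> is the indicator of \<open>{..c}\<close>.\<close>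
    define u :: "real ^ 'n" where "u = (\<chi> i. 1 / c $ i)"
    have "chi_fun p u x = indicator {..c} x" for x
      using PInf c by (auto simp: chi_fun_def u_def less_eq_vec_def indicator_def field_simps)
    then have *: "chi_fun p u = indicator {..c}" by blast
    have u: "u \<in> nonneg_orthant" using c by (simp add: u_def nonneg_orthant_def less_imp_le)
    show "measure \<mu> {..c} = measure \<nu> {..c}"
      using eq[OF u] by (simp add: * borel_space_UNIV sets)
  qed
qed (use p in simp)

section \<open>Stability\<close>

lemma p_sum_in_nonneg_orthant:
  assumes "x \<in> nonneg_orthant" "y \<in> nonneg_orthant"
  shows "p_sum p x y \<in> nonneg_orthant"
  using assms by (auto simp: p_sum_def nonneg_orthant_def le_max_iff_disj)

lemma scaleR_in_nonneg_orthant: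
  "0 \<le> c \<Longrightarrow> x \<in> nonneg_orthant \<Longrightarrow> c *\<^sub>R x \<in> nonneg_orthant"
  by (simp add: nonneg_orthant_def)

text \<open>This is why \<open>\<chi>\<^sub>u\<close> is the right transform: it is a character of the \<open>p\<close>-sum.\<close>

lemma chi_fun_p_sum:
  assumes p: "0 < p" and xyu: "x \<in> nonneg_orthant" "y \<in> nonneg_orthant" "u \<in> nonneg_orthant"
  shows "chi_fun p u (p_sum p x y) = chi_fun p u x * chi_fun p u y"
proof (cases p)
  case (real r)
  have "(p_sum p x y $ i * u $ i) powr r = (x $ i * u $ i) powr r + (y $ i * u $ i) powr r" for i
    using p real by (simp add: p_sum_def powr_mult powr_powr distrib_right)
  then show ?thesis
    using real by (simp add: chi_fun_def sum.distrib exp_add[symmetric])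
next
  case PInf
  have "max (x $ i) (y $ i) * u $ i \<le> 1 \<longleftrightarrow> x $ i * u $ i \<le> 1 \<and> y $ i * u $ i \<le> 1" for i
    using xyu by (simp add: max_mult_distrib_right nonneg_orthant_def)
  then show ?thesis using PInf by (auto simp: chi_fun_def p_sum_def)
qed (use p in simp)

lemma chi_fun_scaleR: "chi_fun p u (c *\<^sub>R x) = chi_fun p (c *\<^sub>R u) x"
  by (simp add: chi_fun_def mult_ac)

text \<open>By independence the left-hand side of the stability identity has the transform
  \<open>exp (- h (a u)) exp (- h (b u))\<close>, and homogeneity turns this into \<open>exp (- h ((a + b) u))\<close>, the
  transform of \<open>(a + b) \<xi>\<close>.\<close>

lemma strictly_p_stable_of_homogeneous_transform:
  fixes \<xi> :: "'w \<Rightarrow> real ^ 'n"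
  assumes p: "0 < p" and "prob_space M" and \<xi> [measurable]: "\<xi> \<in> borel_measurable M"
    and pos: "\<forall>\<omega>\<in>space M. \<xi> \<omega> \<in> nonneg_orthant"
    and transform: "\<And>u. u \<in> nonneg_orthant \<Longrightarrow> (\<integral>\<omega>. chi_fun p u (\<xi> \<omega>) \<partial>M) = exp (- h u)"
    and hom: "\<And>c u. 0 < c \<Longrightarrow> h (c *\<^sub>R u) = c * h u"
  shows "strictly_p_stable p 1 M \<xi>"
  unfolding strictly_p_stable_def
proof (intro allI impI)
  fix a b :: real assume ab: "0 < a" "0 < b"
  interpret prob_space M by fact
  interpret MM: pair_prob_space M M ..
  define S where "S = (\<lambda>(\<omega>1, \<omega>2). p_sum p (a *\<^sub>R \<xi> \<omega>1) (b *\<^sub>R \<xi> \<omega>2))"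
  have [measurable]: "S \<in> borel_measurable (M \<Otimes>\<^sub>M M)" unfolding S_def by measurable
  have S_pos: "S z \<in> nonneg_orthant" if "z \<in> space (M \<Otimes>\<^sub>M M)" for z
    using that pos ab
    by (auto simp: S_def space_pair_measure intro!: p_sum_in_nonneg_orthant scaleR_in_nonneg_orthant)
  have "distr (M \<Otimes>\<^sub>M M) borel S = distr M borel (\<lambda>\<omega>. (a + b) *\<^sub>R \<xi> \<omega>)"
  proof (rule chi_fun_determines[OF p])
    show "finite_measure (distr (M \<Otimes>\<^sub>M M) borel S)"
      by (intro prob_space.finite_measure MM.prob_space_distr) simp
    show "finite_measure (distr M borel (\<lambda>\<omega>. (a + b) *\<^sub>R \<xi> \<omega>))"
      by (intro prob_space.finite_measure prob_space_distr) simp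
    have "{x \<in> space borel. \<forall>i. 0 \<le> x $ i} \<in> sets (borel :: (real ^ 'n) measure)"
      by measurable
    then have orth: "nonneg_orthant \<in> sets (borel :: (real ^ 'n) measure)"
      by (simp add: nonneg_orthant_def)
    show "AE x in distr (M \<Otimes>\<^sub>M M) borel S. x \<in> nonneg_orthant"
      using S_pos by (subst AE_distr_iff) (auto simp: orth intro!: AE_I2)
    show "AE x in distr M borel (\<lambda>\<omega>. (a + b) *\<^sub>R \<xi> \<omega>). x \<in> nonneg_orthant"
      using pos ab by (subst AE_distr_iff)
        (auto simp: orth intro!: AE_I2 scaleR_in_nonneg_orthant)
    fix u :: "real ^ 'n" assume u: "u \<in> nonneg_orthant"
    define A where "A c \<omega> = chi_fun p (c *\<^sub>R u) (\<xi> \<omega>)" for c \<omega>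
    have [measurable]: "A c \<in> borel_measurable M" for c unfolding A_def[abs_def] by simp
    have A: "(\<integral>\<omega>. A c \<omega> \<partial>M) = exp (- (c * h u))" if "0 < c" for c
      using transform[OF scaleR_in_nonneg_orthant[OF _ u]] hom that by (simp add: A_def)
    have A_le: "\<bar>A c \<omega>\<bar> \<le> 1" for c \<omega> using chi_fun_bounds by (simp add: A_def abs_le_iff order.trans[OF _ chi_fun_bounds(1)])
    have int: "integrable (M \<Otimes>\<^sub>M M) (\<lambda>(\<omega>1, \<omega>2). A a \<omega>1 * A b \<omega>2)"
      using A_le by (intro MM.integrable_const_bound[of _ 1]) (auto simp: abs_mult mult_le_one)
    have "integral\<^sup>L (distr (M \<Otimes>\<^sub>M M) borel S) (chi_fun p u) = (\<integral>z. chi_fun p u (S z) \<partial>(M \<Otimes>\<^sub>M M))"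
      by (rule integral_distr) simp_all
    also have "\<dots> = (\<integral>(\<omega>1, \<omega>2). A a \<omega>1 * A b \<omega>2 \<partial>(M \<Otimes>\<^sub>M M))"
      using pos ab u
      by (intro Bochner_Integration.integral_cong)
        (auto simp: S_def A_def space_pair_measure chi_fun_p_sum[OF p] chi_fun_scaleR
          scaleR_in_nonneg_orthant)
    also have "\<dots> = (\<integral>\<omega>1. (\<integral>\<omega>2. A a \<omega>1 * A b \<omega>2 \<partial>M) \<partial>M)"
      by (rule MM.integral_fst[OF int, symmetric])
    also have "\<dots> = exp (- (a * h u)) * exp (- (b * h u))"
      using ab by (simp add: A)
    also have "\<dots> = (\<integral>\<omega>. A (a + b) \<omega> \<partial>M)"
      using ab by (simp add: A exp_add[symmetric] distrib_right)
    also have "\<dots> = integral\<^sup>L (distr M borel (\<lambda>\<omega>. (a + b) *\<^sub>R \<xi> \<omega>)) (chi_fun p u)"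
      by (subst integral_distr) (simp_all add: A_def[abs_def] chi_fun_scaleR)
    finally show "integral\<^sup>L (distr (M \<Otimes>\<^sub>M M) borel S) (chi_fun p u) =
        integral\<^sup>L (distr M borel (\<lambda>\<omega>. (a + b) *\<^sub>R \<xi> \<omega>)) (chi_fun p u)" .
  qed simp_all
  then show "distr (M \<Otimes>\<^sub>M M) borel
        (\<lambda>(\<omega>1, \<omega>2). p_sum p (a powr (1 / 1) *\<^sub>R \<xi> \<omega>1) (b powr (1 / 1) *\<^sub>R \<xi> \<omega>2))
      = distr M borel (\<lambda>\<omega>. (a + b) powr (1 / 1) *\<^sub>R \<xi> \<omega>)"
    using ab by (simp add: S_def)
qed

theorem theorem7p4:
  fixes p :: ereal and \<sigma> :: "(real ^ 'n) measure"
    and M :: "'w measure" and \<xi> :: "'w \<Rightarrow> real ^ 'n"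
  assumes "1 < p"
    and "sets \<sigma> = sets (restrict_space borel nonneg_sphere)" and "finite_measure \<sigma>"
    and "prob_space M" and "\<xi> \<in> borel_measurable M"
    and "\<forall>\<omega>\<in>space M. \<xi> \<omega> \<in> nonneg_orthant"
  shows "(strictly_p_stable p 1 M \<xi> \<and> has_spectral_measure p 1 M \<xi> \<sigma>) \<longleftrightarrow>
    (\<forall>u\<in>nonneg_orthant.
      (\<integral>\<omega>. chi_fun p u (\<xi> \<omega>) \<partial>M) =
      exp (- support_function
              (L1_zonoid p (scale_measure (ennreal (Gamma (1 - real_of_ereal (1 / p)))) \<sigma>)) u))"
proof -
  define g where "g = Gamma (1 - real_of_ereal (1 / p))"
  define h where "h u = g * (\<integral>y. lq_norm p (y * u) \<partial>\<sigma>)" for u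
  have p0: "0 < p" using order.strict_trans[of 0 1 p] assms(1) by simp
  have g: "0 < g" unfolding g_def by (rule Gamma_one_minus_inverse_pos[OF assms(1)])
  interpret \<sigma>: finite_measure \<sigma> by fact
  have dens: "scale_measure (ennreal g) \<sigma> = density \<sigma> (\<lambda>_. ennreal g)"
    by (rule scale_measure_eq_density)
  have "finite_measure (scale_measure (ennreal g) \<sigma>)"
    by (rule finite_measureI)
      (simp add: space_scale_measure \<sigma>.emeasure_eq_measure ennreal_mult_eq_top_iff)
  then have "support_function (L1_zonoid p (scale_measure (ennreal g) \<sigma>)) u =
      (\<integral>y. lq_norm p (y * u) \<partial>scale_measure (ennreal g) \<sigma>)" for u
    by (intro support_function_L1_zonoid assms(1)) (simp_all add: assms(2))
  also have "(\<integral>y. lq_norm p (y * u) \<partial>scale_measure (ennreal g) \<sigma>) = h u" for u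
    using g integrable_lq_norm_times[of p \<sigma> u] p0 assms(2,3)
    by (simp add: dens integral_real_density h_def)
  finally have zonoid: "support_function (L1_zonoid p (scale_measure (ennreal g) \<sigma>)) u = h u" for u .
  have hom: "h (c *\<^sub>R u) = c * h u" if "0 < c" for c u
    using that by (simp add: h_def mult_scaleR_right lq_norm_scaleR assms(1))
  have spectral: "has_spectral_measure p 1 M \<xi> \<sigma> \<longleftrightarrow>
      (\<forall>u\<in>nonneg_orthant. (\<integral>\<omega>. chi_fun p u (\<xi> \<omega>) \<partial>M) = exp (- h u))"
    using levy_integral[OF assms(1-3)] by (simp add: has_spectral_measure_def h_def g_def)
  have "strictly_p_stable p 1 M \<xi>" if "has_spectral_measure p 1 M \<xi> \<sigma>"
    using that spectral hom
    by (intro strictly_p_stable_of_homogeneous_transform[OF p0 assms(4-6), of h]) auto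
  then show ?thesis
    unfolding g_def[symmetric] zonoid spectral[symmetric] by blast
qed

end
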